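(* Let $1\le r\le n(n+1)/2$ and let $\sigma_r=\bigwedge^r\sigma_1$, where $\sigma_1$ is the $K$-rational representation of $\mathrm{GL}(n,F)$ on $\Omega_K^1$ defined by $\sigma_1(h)\,dZ=h\cdot dZ\cdot{}^th$. Then the action of $G=\mathrm{Sp}(2n,F)$ on the space $\Omega^r(\Sigma)$ of rigid analytic exterior differential $r$-forms on the $p$-adic Siegel upper half-space coincides with the holomorphic discrete series representation $\pi_{\sigma_r}$ on $\mathscr{O}_{\sigma_r}(\Sigma)=\mathscr{O}(\Sigma)\otimes_K\Omega^r_K=\Omega^r(\Sigma)$.
   Context: $n$ is a positive integer. $F/\mathbb{Q}_p$ is finite with ring of integers $\mathfrak{o}$, uniformizer $\varpi$, normalized absolute value $|\ |$; $K\supseteq F$ is complete for an absolute value extending $|\ |$. $G=\mathrm{Sp}(2n,F)=\{g\in\mathrm{GL}(2n,F):{}^tgJ_ng=J_n\}$, $J_n=\begin{pmatrix}0&I_n\\-I_n&0\end{pmatrix}$. $\mathcal{P}$ is the set of pairs $(X,Y)$ of $n\times n$ matrices over $F$ with $X\,{}^tY=Y\,{}^tX$, $\mathrm{rank}(X\;Y)=n$; $\mathcal{P}_\mathfrak{o}$ is the set of pairs $(C,D)$ forming the lower rows of elements $\begin{pmatrix}A&B\\C&D\end{pmatrix}$ of $\mathrm{Sp}(2n,\mathfrak{o})$. For symmetric $Z$, $|Z|=\max_{i\le j}\{1,|Z_{ij}|\}$. The $p$-adic Siegel upper half-space $\mathbf{\Sigma}=\{Z:\det(XZ+Y)\ne0\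 \forall(X,Y)\in\mathcal{P}\}$ (inside the rigid affine space of symmetric $n\times n$ matrices) has the increasing admissible affinoid covering $\mathbf{\Sigma}(m)=\{Z:|\det(XZ+Y)|\ge|Z|^n|\varpi|^{nm}\ \forall(X,Y)\in\mathcal{P}_\mathfrak{o}\}$, $m\ge0$. $\mathbf{\Sigma}_K$ denotes the base change of $\mathbf{\Sigma}$ to $K$ and $\Sigma$ its set of $K$-points; $\mathscr{O}(\Sigma)=\varprojlim_m\mathscr{O}(\Sigma(m))$ is the space of $K$-rigid analytic functions on $\mathbf{\Sigma}_K$, where $\mathscr{O}(\Sigma(m))$ is the space of $K$-rigid analytic functions on the base change of $\mathbf{\Sigma}(m)$. $G$ acts on $\mathbf{\Sigma}$ by $gZ=(AZ+B)(CZ+D)^{-1}$; $j(g,Z)=CZ+D$ for $g=\begin{pmatrix}A&B\\C&D\end{pmatrix}$. For a finite-dimensional $K$-rational representation $(V,\sigma)$ of $\mathrm{GL}(n,F)$ (i.e. $\sigma(h)=\det(h)^{-s}P(h)$ with $s\in\mathbb{N}$ (nonnegative integers) and $P$ a matrix of polynomials over $K$ in the $h_{ij}$), the holomorphic discrete series $(\mathscr{O}_\sigma(\Sigma),\pi_\sigma)$ is $\mathscr{O}_\sigma(\Sigma)=\mathscr{O}(\Sigma)\otimes_KV$ with $(\pi_\sigma(g)\psi)(Z)=\sigma(j(g^{-1},Z))^{-1}\psi(g^{-1}Z)$ for $g\in G$. Differential forms: $\Omega_K^1=\bigoplus_{1\le i\le j\le n}K\,dZ_{ij}$, $\Omega_K^r=\bigwedge^r\Omega^1_K$,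 $\Omega^r(\Sigma)=\mathscr{O}(\Sigma)\otimes_K\Omega^r_K$. $G$ acts on $\Omega^r(\Sigma)$ through its action on $\Sigma$, by pullback along $Z\mapsto g^{-1}Z$. With $dZ=(dZ_{ij})$ the symmetric matrix of differentials, the formula $\sigma_1(h)\,dZ=h\cdot dZ\cdot{}^th$ means, in coordinates, $\sigma_1(h)\,dZ_{ij}=\sum_{1\le k<\ell\le n}(h_{ik}h_{j\ell}+h_{i\ell}h_{jk})\,dZ_{k\ell}+\sum_{k=1}^n h_{ik}h_{jk}\,dZ_{kk}$.
   Formalization: σ₁(h) is taken as S ↦ h·S·ᵗh on symmetric coefficient matrices of forms tr(S dZ), i.e. σ₁(h)dZ = ᵗh·dZ·h on the dZ_ij; the printed σ₁(h)dZ = h·dZ·ᵗh on the dZ_ij is an anti-homomorphism, and the claim fails for it (n=2, r=1). *)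

theory Defs
  imports
    "HOL-Computational_Algebra.Polynomial"
    "HOL-Library.FuncSet"
    "HOL-Library.Product_Lexorder"
    "Jordan_Normal_Form.Determinant"
    "Jordan_Normal_Form.Gauss_Jordan_Elimination"
    "Jordan_Normal_Form.DL_Rank"
begin

section \<open>Valued fields\<close>

text \<open>
  All fields live inside one field \<open>'l\<close>, called \<open>L\<close> in the comments: \<open>F \<subseteq> K \<subseteq> L\<close>.
  The field \<open>L\<close> is complete and algebraically closed; it only serves to provide enough
  geometric points for the rigid analytic spaces over \<open>K\<close>.  The \<open>K\<close>-points do not
  suffice for that: for \<open>K = F\<close> there is no \<open>K\<close>-point in the Siegel upper half-space at all.
\<close>

definition nonarch_abs :: "('l::field \<Rightarrow> real) \<Rightarrow> bool" where
  "nonarch_abs v \<longleftrightarrow>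
     (\<forall>x. 0 \<le> v x) \<and> (\<forall>x. v x = 0 \<longleftrightarrow> x = 0) \<and>
     (\<forall>x y. v (x * y) = v x * v y) \<and> (\<forall>x y. v (x + y) \<le> max (v x) (v y))"

definition complete_for :: "('l::field \<Rightarrow> real) \<Rightarrow> 'l set \<Rightarrow> bool" where
  "complete_for v S \<longleftrightarrow>
     (\<forall>s :: nat \<Rightarrow> 'l. range s \<subseteq> S \<and> (\<forall>e>0. \<exists>N. \<forall>i\<ge>N. \<forall>j\<ge>N. v (s i - s j) < e) \<longrightarrow>
        (\<exists>x\<in>S. \<forall>e>0. \<exists>N. \<forall>i\<ge>N. v (s i - x) < e))"

definition is_subfield :: "'l::field set \<Rightarrow> bool" where
  "is_subfield S \<longleftrightarrow>
     1 \<in> S \<and> (\<forall>x\<in>S. \<forall>y\<in>S. x - y \<in> S) \<and> (\<forall>x\<in>S. \<forall>y\<in>S. x * y \<in> S) \<and>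
     (\<forall>x\<in>S. inverse x \<in> S)"

text \<open>
  If \<open>v\<close> is non-archimedean with \<open>v p < 1\<close>, then \<open>v\<close> induces the \<open>p\<close>-adic topology on the
  rational numbers, so their closure, once it is complete, is \<open>\<rat>\<^sub>p\<close>.
\<close>

definition rat_closure :: "('l::field_char_0 \<Rightarrow> real) \<Rightarrow> 'l set" where
  "rat_closure v = {x. \<forall>e>0. \<exists>q\<in>\<rat>. v (x - q) < e}"

definition finite_extension_Qp :: "nat \<Rightarrow> ('l::field_char_0 \<Rightarrow> real) \<Rightarrow> 'l set \<Rightarrow> bool" where
  "finite_extension_Qp p v F \<longleftrightarrow>
     prime p \<and> v (of_nat p) < 1 \<and> complete_for v (rat_closure v) \<and>
     is_subfield F \<and> rat_closure v \<subseteq> F \<and>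
     (\<exists>B. finite B \<and> B \<subseteq> F \<and>
        (\<forall>x\<in>F. \<exists>c. (\<forall>b\<in>B. c b \<in> rat_closure v) \<and> x = (\<Sum>b\<in>B. c b * b)))"

definition integer_ring :: "('l::field \<Rightarrow> real) \<Rightarrow> 'l set \<Rightarrow> 'l set" where
  "integer_ring v F = {x \<in> F. v x \<le> 1}"

definition uniformizer :: "('l::field \<Rightarrow> real) \<Rightarrow> 'l set \<Rightarrow> 'l \<Rightarrow> bool" where
  "uniformizer v F \<pi> \<longleftrightarrow>
     \<pi> \<in> F \<and> \<pi> \<noteq> 0 \<and> v \<pi> < 1 \<and> (\<forall>x\<in>F. v x < 1 \<longrightarrow> v x \<le> v \<pi>)"

definition residue_card :: "('l::field \<Rightarrow> real) \<Rightarrow> 'l set \<Rightarrow> nat" where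
  "residue_card v F =
     card (integer_ring v F //
       {(x, y). x \<in> integer_ring v F \<and> y \<in> integer_ring v F \<and> v (x - y) < 1})"

definition normalized_on :: "('l::field \<Rightarrow> real) \<Rightarrow> 'l set \<Rightarrow> bool" where
  "normalized_on v F \<longleftrightarrow> (\<forall>\<pi>. uniformizer v F \<pi> \<longrightarrow> v \<pi> = 1 / real (residue_card v F))"


section \<open>The symplectic group\<close>

definition mats_over :: "nat \<Rightarrow> 'l set \<Rightarrow> 'l mat set" where
  "mats_over n R = {A \<in> carrier_mat n n. elements_mat A \<subseteq> R}"

definition GL :: "nat \<Rightarrow> 'l::field set \<Rightarrow> 'l mat set" where
  "GL n R = {g \<in> mats_over n R. \<exists>h \<in> mats_over n R. g * h = 1\<^sub>m n \<and> h * g = 1\<^sub>m n}"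

definition J_mat :: "nat \<Rightarrow> 'l::field mat" where
  "J_mat n = four_block_mat (0\<^sub>m n n) (1\<^sub>m n) (- 1\<^sub>m n) (0\<^sub>m n n)"

definition Sp :: "nat \<Rightarrow> 'l::field set \<Rightarrow> 'l mat set" where
  "Sp n R = {g \<in> GL (2 * n) R. transpose_mat g * J_mat n * g = J_mat n}"

definition minv :: "'l::field mat \<Rightarrow> 'l mat" where
  "minv A = the (mat_inverse A)"

definition moebius :: "nat \<Rightarrow> 'l::field mat \<Rightarrow> 'l mat \<Rightarrow> 'l mat" where
  "moebius n g Z = (case split_block g n n of (A, B, C, D) \<Rightarrow> (A * Z + B) * minv (C * Z + D))"

definition jfac :: "nat \<Rightarrow> 'l::field mat \<Rightarrow> 'l mat \<Rightarrow> 'l mat" where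
  "jfac n g Z = (case split_block g n n of (A, B, C, D) \<Rightarrow> C * Z + D)"


section \<open>The Siegel upper half-space and its rigid analytic functions\<close>

text \<open>
  The rank of the \<open>n \<times> 2n\<close> matrix \<open>(X Y)\<close>; it is the same over \<open>F\<close> and over \<open>L\<close>.
\<close>

definition pairs_P :: "'l::field set \<Rightarrow> nat \<Rightarrow> ('l mat \<times> 'l mat) set" where
  "pairs_P F n = {(X, Y). X \<in> mats_over n F \<and> Y \<in> mats_over n F \<and>
     X * transpose_mat Y = Y * transpose_mat X \<and>
     vec_space.rank n (four_block_mat X Y (0\<^sub>m 0 n) (0\<^sub>m 0 n)) = n}"

definition pairs_Po :: "('l::field \<Rightarrow> real) \<Rightarrow> 'l set \<Rightarrow> nat \<Rightarrow> ('l mat \<times> 'l mat) set" where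
  "pairs_Po v F n = {(C, D). \<exists>A B. A \<in> carrier_mat n n \<and> B \<in> carrier_mat n n \<and>
     C \<in> carrier_mat n n \<and> D \<in> carrier_mat n n \<and>
     four_block_mat A B C D \<in> Sp n (integer_ring v F)}"

definition sym_mats :: "nat \<Rightarrow> 'l mat set" where
  "sym_mats n = {Z \<in> carrier_mat n n. transpose_mat Z = Z}"

definition mat_abs :: "('l::field \<Rightarrow> real) \<Rightarrow> nat \<Rightarrow> 'l mat \<Rightarrow> real" where
  "mat_abs v n Z = Max (insert 1 {v (Z $$ (i, j)) | i j. i \<le> j \<and> j < n})"

text \<open>The sets of \<open>L\<close>-points of the half-space and of its affinoid covering.\<close>

definition Siegel :: "'l::field set \<Rightarrow> nat \<Rightarrow> 'l mat set" where
  "Siegel F n = {Z \<in> sym_mats n. \<forall>(X, Y) \<in> pairs_P F n. det (X * Z + Y) \<noteq> 0}"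

definition Siegel_aff :: "('l::field \<Rightarrow> real) \<Rightarrow> 'l set \<Rightarrow> 'l \<Rightarrow> nat \<Rightarrow> nat \<Rightarrow> 'l mat set" where
  "Siegel_aff v F \<pi> n m = {Z \<in> sym_mats n. \<forall>(X, Y) \<in> pairs_Po v F n.
     mat_abs v n Z ^ n * v \<pi> ^ (n * m) \<le> v (det (X * Z + Y))}"

text \<open>Polynomial functions, with coefficients in \<open>K\<close>, of the entries of an \<open>n \<times> n\<close> matrix.\<close>

inductive_set poly_fun :: "'l::field set \<Rightarrow> nat \<Rightarrow> ('l mat \<Rightarrow> 'l) set" for K n where
  const: "c \<in> K \<Longrightarrow> (\<lambda>Z. c) \<in> poly_fun K n"
| entry: "i < n \<Longrightarrow> j < n \<Longrightarrow> (\<lambda>Z. Z $$ (i, j)) \<in> poly_fun K n"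
| add: "P \<in> poly_fun K n \<Longrightarrow> Q \<in> poly_fun K n \<Longrightarrow> (\<lambda>Z. P Z + Q Z) \<in> poly_fun K n"
| mult: "P \<in> poly_fun K n \<Longrightarrow> Q \<in> poly_fun K n \<Longrightarrow> (\<lambda>Z. P Z * Q Z) \<in> poly_fun K n"

text \<open>
  The affinoid \<open>\<Sigma>(m)\<close> is a rational subdomain of a closed polydisc, defined by the
  inequalities \<open>|\<pi>\<^sup>n\<^sup>m M(Z)| \<le> |det (XZ + Y)|\<close> with \<open>M\<close> running over \<open>1\<close> and the \<open>n\<close>-th powers of
  the coordinates; finitely many \<open>(X, Y)\<close> suffice.  Hence its affinoid algebra over \<open>K\<close> is
  reduced, and is the completion, for the supremum norm over the geometric points, of the
  algebra of rational functions over \<open>K\<close> without poles on \<open>\<Sigma>(m)\<close>.  Its elements are therefore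
  the uniform limits of such rational functions.
\<close>

definition O_aff ::
  "('l::field \<Rightarrow> real) \<Rightarrow> 'l set \<Rightarrow> 'l set \<Rightarrow> 'l \<Rightarrow> nat \<Rightarrow> nat \<Rightarrow> ('l mat \<Rightarrow> 'l) set" where
  "O_aff v F K \<pi> n m = {f \<in> extensional (Siegel_aff v F \<pi> n m).
     \<forall>e>0. \<exists>P \<in> poly_fun K n. \<exists>Q \<in> poly_fun K n.
       \<forall>Z \<in> Siegel_aff v F \<pi> n m. Q Z \<noteq> 0 \<and> v (f Z - P Z / Q Z) < e}"

text \<open>
  The projective limit of the preceding algebras along restriction: \<open>\<Sigma>\<close> is the increasing
  union of the \<open>\<Sigma>(m)\<close>.
\<close>

definition O_Siegel ::
  "('l::field \<Rightarrow> real) \<Rightarrow> 'l set \<Rightarrow> 'l set \<Rightarrow> 'l \<Rightarrow> nat \<Rightarrow> ('l mat \<Rightarrow> 'l) set" where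
  "O_Siegel v F K \<pi> n = {f \<in> extensional (Siegel F n).
     \<forall>m. restrict f (Siegel_aff v F \<pi> n m) \<in> O_aff v F K \<pi> n m}"


section \<open>Holomorphic discrete series\<close>

text \<open>
  A finite-dimensional \<open>K\<close>-vector space \<open>V\<close> is given by a finite set \<open>B\<close> indexing a basis; then
  \<open>V \<otimes>\<^sub>K L\<close> is \<open>coord_space B\<close>.  As \<open>\<sigma>(h) = det(h)\<^sup>-\<^sup>s P(h)\<close> has to be evaluated at
  \<open>h = j(g, Z)\<close>, which is an \<open>L\<close>-valued matrix, \<open>\<sigma>\<close> is given on \<open>GL(n, L)\<close>.
\<close>

definition coord_space :: "'b set \<Rightarrow> ('b \<Rightarrow> 'l::zero) set" where
  "coord_space B = {w. \<forall>b. b \<notin> B \<longrightarrow> w b = 0}"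

definition K_rational_rep ::
  "'l::field set \<Rightarrow> 'l set \<Rightarrow> nat \<Rightarrow> 'b set \<Rightarrow> ('l mat \<Rightarrow> ('b \<Rightarrow> 'l) \<Rightarrow> ('b \<Rightarrow> 'l)) \<Rightarrow> bool" where
  "K_rational_rep F K n B \<sigma> \<longleftrightarrow>
     finite B \<and>
     (\<exists>(s::nat) P. (\<forall>a\<in>B. \<forall>b\<in>B. P a b \<in> poly_fun K n) \<and>
        (\<forall>h \<in> GL n UNIV. \<forall>w \<in> coord_space B.
           \<sigma> h w = (\<lambda>a. if a \<in> B then \<Sum>b\<in>B. P a b h / det h ^ s * w b else 0))) \<and>
     (\<forall>w \<in> coord_space B. \<sigma> (1\<^sub>m n) w = w) \<and>
     (\<forall>g \<in> GL n F. \<forall>h \<in> GL n F. \<forall>w \<in> coord_space B. \<sigma> (g * h) w = \<sigma> g (\<sigma> h w))"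

text \<open>The space \<open>\<O>(\<Sigma>) \<otimes>\<^sub>K V\<close>.\<close>

definition O_tensor ::
  "('l::field \<Rightarrow> real) \<Rightarrow> 'l set \<Rightarrow> 'l set \<Rightarrow> 'l \<Rightarrow> nat \<Rightarrow> 'b set \<Rightarrow> ('l mat \<Rightarrow> 'b \<Rightarrow> 'l) set" where
  "O_tensor v F K \<pi> n B = {\<psi> \<in> Siegel F n \<rightarrow>\<^sub>E coord_space B.
     \<forall>b\<in>B. (\<lambda>Z\<in>Siegel F n. \<psi> Z b) \<in> O_Siegel v F K \<pi> n}"

definition hol_disc_series ::
  "'l::field set \<Rightarrow> nat \<Rightarrow> 'b set \<Rightarrow> ('l mat \<Rightarrow> ('b \<Rightarrow> 'l) \<Rightarrow> ('b \<Rightarrow> 'l)) \<Rightarrow>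
    'l mat \<Rightarrow> ('l mat \<Rightarrow> 'b \<Rightarrow> 'l) \<Rightarrow> ('l mat \<Rightarrow> 'b \<Rightarrow> 'l)" where
  "hol_disc_series F n B \<sigma> g \<psi> =
     (\<lambda>Z\<in>Siegel F n.
        inv_into (coord_space B) (\<sigma> (jfac n (minv g) Z)) (\<psi> (moebius n (minv g) Z)))"


section \<open>Exterior powers\<close>

text \<open>
  For a space with basis indexed by \<open>B\<close>, its \<open>r\<close>-th exterior power has as basis the products
  \<open>e\<^sub>I = e\<^bsub>i\<^sub>1\<^esub> \<and> \<dots> \<and> e\<^bsub>i\<^sub>r\<^esub>\<close> for \<open>I = {i\<^sub>1 < \<dots> < i\<^sub>r} \<subseteq> B\<close>.
\<close>

definition ext_basis :: "'b set \<Rightarrow> nat \<Rightarrow> 'b set set" where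
  "ext_basis B r = {I. I \<subseteq> B \<and> card I = r}"

text \<open>\<open>wedge1 \<alpha> u = \<alpha> \<and> u\<close>: moving \<open>e\<^sub>b\<close> to its place in \<open>e\<^sub>I\<close> passes the \<open>e\<^sub>c\<close> with \<open>c < b\<close>.\<close>

definition wedge1 ::
  "('b::linorder \<Rightarrow> 'l::field) \<Rightarrow> ('b set \<Rightarrow> 'l) \<Rightarrow> ('b set \<Rightarrow> 'l)" where
  "wedge1 \<alpha> u = (\<lambda>I. \<Sum>b\<in>I. (-1) ^ card {c \<in> I. c < b} * \<alpha> b * u (I - {b}))"

definition wedge_list :: "('b::linorder \<Rightarrow> 'l::field) list \<Rightarrow> ('b set \<Rightarrow> 'l)" where
  "wedge_list \<alpha>s = foldr wedge1 \<alpha>s (\<lambda>I. if I = {} then 1 else 0)"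

text \<open>The linear map sending \<open>e\<^bsub>i\<^sub>1\<^esub> \<and> \<dots> \<and> e\<^bsub>i\<^sub>r\<^esub>\<close> to \<open>t i\<^sub>1 \<and> \<dots> \<and> t i\<^sub>r\<close>.\<close>

definition ext_map ::
  "'b::linorder set \<Rightarrow> nat \<Rightarrow> ('b \<Rightarrow> ('b \<Rightarrow> 'l::field)) \<Rightarrow> ('b set \<Rightarrow> 'l) \<Rightarrow> ('b set \<Rightarrow> 'l)" where
  "ext_map B r t u =
     (\<lambda>J. \<Sum>I\<in>ext_basis B r. u I * wedge_list (map t (sorted_list_of_set I)) J)"

definition ext_power ::
  "'b::linorder set \<Rightarrow> nat \<Rightarrow> (('b \<Rightarrow> 'l::field) \<Rightarrow> ('b \<Rightarrow> 'l)) \<Rightarrow> ('b set \<Rightarrow> 'l) \<Rightarrow> ('b set \<Rightarrow> 'l)" where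
  "ext_power B r T = ext_map B r (\<lambda>b. T (\<lambda>c. if c = b then 1 else 0))"


section \<open>Differential forms\<close>

text \<open>The basis \<open>dZ\<^sub>i\<^sub>j\<close>, \<open>i \<le> j\<close>, of the one-forms, with indices counted from \<open>0\<close>.\<close>

definition idx :: "nat \<Rightarrow> (nat \<times> nat) set" where
  "idx n = {(i, j). i \<le> j \<and> j < n}"

definition partial_deriv ::
  "('l::field \<Rightarrow> real) \<Rightarrow> nat \<Rightarrow> ('l mat \<Rightarrow> 'l) \<Rightarrow> nat \<times> nat \<Rightarrow> 'l mat \<Rightarrow> 'l" where
  "partial_deriv v n f b Z = (case b of (i, j) \<Rightarrow>
     (let E = mat n n (\<lambda>c. if c = (i, j) \<or> c = (j, i) then 1 else 0) in
      THE d. \<forall>e>0. \<exists>\<delta>>0. \<forall>t. t \<noteq> 0 \<and> v t < \<delta> \<longrightarrow>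
        v ((f (Z + t \<cdot>\<^sub>m E) - f Z) / t - d) < e))"

text \<open>\<open>df = \<Sum>\<^bsub>i\<le>j\<^esub> (\<partial>f / \<partial>Z\<^sub>i\<^sub>j) dZ\<^sub>i\<^sub>j\<close> at the point \<open>Z\<close>.\<close>

definition differential ::
  "('l::field \<Rightarrow> real) \<Rightarrow> nat \<Rightarrow> ('l mat \<Rightarrow> 'l) \<Rightarrow> 'l mat \<Rightarrow> (nat \<times> nat \<Rightarrow> 'l)" where
  "differential v n f Z = (\<lambda>b. if b \<in> idx n then partial_deriv v n f b Z else 0)"

text \<open>
  The pullback of \<open>\<omega> = \<Sum>\<^sub>I \<omega>\<^sub>I dZ\<^bsub>i\<^sub>1\<^esub> \<and> \<dots> \<and> dZ\<^bsub>i\<^sub>r\<^esub>\<close> along \<open>\<phi>\<close> is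
  \<open>\<Sum>\<^sub>I (\<omega>\<^sub>I \<circ> \<phi>) d\<phi>\<^bsub>i\<^sub>1\<^esub> \<and> \<dots> \<and> d\<phi>\<^bsub>i\<^sub>r\<^esub>\<close>.
\<close>

definition pullback ::
  "('l::field \<Rightarrow> real) \<Rightarrow> nat \<Rightarrow> nat \<Rightarrow> ('l mat \<Rightarrow> 'l mat) \<Rightarrow>
    ('l mat \<Rightarrow> (nat \<times> nat) set \<Rightarrow> 'l) \<Rightarrow> ('l mat \<Rightarrow> (nat \<times> nat) set \<Rightarrow> 'l)" where
  "pullback v n r \<phi> \<omega> Z =
     ext_map (idx n) r (\<lambda>b. differential v n (\<lambda>W. \<phi> W $$ b) Z) (\<omega> (\<phi> Z))"

definition forms_action ::
  "('l::field \<Rightarrow> real) \<Rightarrow> 'l set \<Rightarrow> nat \<Rightarrow> nat \<Rightarrow> 'l mat \<Rightarrow>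
    ('l mat \<Rightarrow> (nat \<times> nat) set \<Rightarrow> 'l) \<Rightarrow> ('l mat \<Rightarrow> (nat \<times> nat) set \<Rightarrow> 'l)" where
  "forms_action v F n r g \<omega> = (\<lambda>Z\<in>Siegel F n. pullback v n r (moebius n (minv g)) \<omega> Z)"

definition rigid_forms ::
  "('l::field \<Rightarrow> real) \<Rightarrow> 'l set \<Rightarrow> 'l set \<Rightarrow> 'l \<Rightarrow> nat \<Rightarrow> nat \<Rightarrow>
    ('l mat \<Rightarrow> (nat \<times> nat) set \<Rightarrow> 'l) set" where
  "rigid_forms v F K \<pi> n r = O_tensor v F K \<pi> n (ext_basis (idx n) r)"


section \<open>The representation \<open>\<sigma>\<^sub>r\<close>\<close>

text \<open>
  A one-form \<open>w = \<Sum>\<^bsub>i\<le>j\<^esub> w\<^sub>i\<^sub>j dZ\<^sub>i\<^sub>j\<close> is uniquely \<open>tr (S dZ) = \<Sum>\<^bsub>i,j\<^esub> S\<^sub>i\<^sub>j dZ\<^sub>i\<^sub>j\<close> with \<open>S\<close> symmetric.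
  In these coordinates \<open>\<sigma>\<^sub>1(h)\<close> is \<open>S \<mapsto> h S \<^sup>th\<close>, that is
  \<open>S\<^sub>i\<^sub>j \<mapsto> \<Sum>\<^bsub>k<l\<^esub> (h\<^sub>i\<^sub>k h\<^sub>j\<^sub>l + h\<^sub>i\<^sub>l h\<^sub>j\<^sub>k) S\<^sub>k\<^sub>l + \<Sum>\<^sub>k h\<^sub>i\<^sub>k h\<^sub>j\<^sub>k S\<^sub>k\<^sub>k\<close>.  On the basis vectors themselves this reads
  \<open>\<sigma>\<^sub>1(h) dZ = \<^sup>th dZ h\<close>.  Prescribing \<open>dZ \<mapsto> h dZ \<^sup>th\<close> on the basis vectors instead would give
  \<open>\<sigma>\<^sub>1(gh) = \<sigma>\<^sub>1(h) \<sigma>\<^sub>1(g)\<close>, which is no representation for \<open>n \<ge> 2\<close>.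
\<close>

definition form_to_sym :: "nat \<Rightarrow> (nat \<times> nat \<Rightarrow> 'l::field) \<Rightarrow> 'l mat" where
  "form_to_sym n w =
     mat n n (\<lambda>(i, j). if i = j then w (i, i) else w (min i j, max i j) / 2)"

definition sym_to_form :: "nat \<Rightarrow> 'l::field mat \<Rightarrow> (nat \<times> nat \<Rightarrow> 'l)" where
  "sym_to_form n S = (\<lambda>(i, j). if (i, j) \<in> idx n
     then if i = j then S $$ (i, i) else S $$ (i, j) + S $$ (j, i) else 0)"

definition sigma1 :: "nat \<Rightarrow> 'l::field mat \<Rightarrow> (nat \<times> nat \<Rightarrow> 'l) \<Rightarrow> (nat \<times> nat \<Rightarrow> 'l)" where
  "sigma1 n h w = sym_to_form n (h * form_to_sym n w * transpose_mat h)"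

definition sigma_r ::
  "nat \<Rightarrow> nat \<Rightarrow> 'l::field mat \<Rightarrow> ((nat \<times> nat) set \<Rightarrow> 'l) \<Rightarrow> ((nat \<times> nat) set \<Rightarrow> 'l)" where
  "sigma_r n r h = ext_power (idx n) r (sigma1 n h)"

end

theory Submission
  imports Defs
begin

text \<open>
  The relations between the blocks of \<open>g \<in> Sp(2n, F)\<close> give, for symmetric \<open>Z\<close> and \<open>W\<close>,
  \<open>gW - gZ = \<^sup>tj(g, Z)\<^sup>-\<^sup>1 (W - Z) j(g, W)\<^sup>-\<^sup>1\<close>.  Letting \<open>W\<close> tend to \<open>Z\<close>, the pullback of \<open>dZ\<close>
  along \<open>g\<close> is \<open>\<^sup>th dZ h\<close> with \<open>h = j(g, Z)\<^sup>-\<^sup>1\<close>, which is \<open>\<sigma>\<^sub>1(h) dZ\<close>.  Exterior powers are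
  functorial, so the pullback of \<open>r\<close>-forms is \<open>\<sigma>\<^sub>r(h)\<close>, the inverse of \<open>\<sigma>\<^sub>r(j(g, Z))\<close>.
\<close>

section \<open>Functoriality of exterior powers\<close>

text \<open>Functoriality has to be extracted from coordinates: \<open>wedge1\<close> carries
  explicit signs, and everything reduces to comparing, for an induced map, wedging before and after
  it. The resulting multiplicativity of \<open>sigma_r\<close> holds for all square matrices over
  \<open>'l\<close>. This generality matters, because the entries of j(g, Z) need not lie in F; it
  also supplies the two-sided inverse that \<open>inv_into\<close> asks for. \<open>moebius\<close>
  is total because \<open>minv\<close> is, so its values are meaningful only where det j(g, W) is
  nonzero. The derivative at Z involves the points W = Z + tE, and it is never shown that they stay
  in the half-space: the difference formula asks only for symmetric matrices with nonzero det j, and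
  this determinant is nonzero for small t by continuity. Powers of the uniformizer supply small
  nonzero t, so that the \<open>THE\<close> in \<open>partial_deriv\<close> has a unique candidate.
  Invariance of the half-space is what allows a form to be evaluated at gZ. For this the rank
  condition on the pairs is replaced by the existence of a right inverse, which g
  transports.\<close>

text \<open>Deleting \<open>b\<close> shifts the position of \<open>c\<close> by one exactly when
  \<open>b\<close> stands before \<open>c\<close>.\<close>

lemma sign_remove:
  fixes I :: "'b::linorder set"
  assumes "finite I" "b \<in> I"
  shows "(-1 :: 'l::field) ^ card {x \<in> I - {b}. x < c}
    = (if b < c then - ((-1) ^ card {x \<in> I. x < c}) else (-1) ^ card {x \<in> I. x < c})"
proof (cases "b < c")
  case True
  then have "{x \<in> I. x < c} = insert b {x \<in> I - {b}. x < c}" using assms by auto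
  then have "card {x \<in> I. x < c} = Suc (card {x \<in> I - {b}. x < c})"
    using assms by (simp only:) (subst card_insert_disjoint, auto)
  then show ?thesis using True by simp
next
  case False
  then have "{x \<in> I. x < c} = {x \<in> I - {b}. x < c}" by auto
  then show ?thesis using False by simp
qed

text \<open>Both sides are sums over ordered pairs of distinct elements of \<open>I\<close>, one for
  each of the two factors. Exchanging the order of removal changes the sign of each term. For
  infinite \<open>I\<close> both sums are 0 by convention.\<close>

lemma wedge1_anticommute:
  fixes \<alpha> \<beta> :: "'b::linorder \<Rightarrow> 'l::field"
  shows "wedge1 \<alpha> (wedge1 \<beta> u) I = - wedge1 \<beta> (wedge1 \<alpha> u) I"
proof (cases "finite I")
  case False
  then show ?thesis by (simp add: wedge1_def)
next
  case True
  define s where "s I b = (-1 :: 'l) ^ card {c \<in> I. c < b}" for I and b :: 'b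
  have expand: "wedge1 \<alpha> (wedge1 \<beta> u) I =
      (\<Sum>b\<in>I. \<Sum>c\<in>I. if b = c then 0 else s I b * s (I - {b}) c * \<alpha> b * \<beta> c * u (I - {b, c}))"
    for \<alpha> \<beta>
  proof -
    have "wedge1 \<beta> u (I - {b})
      = (\<Sum>c\<in>I. if b = c then 0 else s (I - {b}) c * \<beta> c * u (I - {b, c}))" if "b \<in> I" for b
    proof -
      have D: "I - {b} - {c} = I - {b, c}" for c by auto
      have "wedge1 \<beta> u (I - {b}) = (\<Sum>c\<in>I - {b}. s (I - {b}) c * \<beta> c * u (I - {b, c}))"
        unfolding wedge1_def s_def D ..
      also have "\<dots> = (\<Sum>c\<in>I. if b = c then 0 else s (I - {b}) c * \<beta> c * u (I - {b, c}))"
        using True by (intro sum.mono_neutral_cong_left) auto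
      finally show ?thesis .
    qed
    then have "wedge1 \<alpha> (wedge1 \<beta> u) I =
      (\<Sum>b\<in>I. s I b * \<alpha> b * (\<Sum>c\<in>I. if b = c then 0 else s (I - {b}) c * \<beta> c * u (I - {b, c})))"
      by (subst wedge1_def) (simp add: s_def)
    also have "\<dots> = (\<Sum>b\<in>I. \<Sum>c\<in>I. if b = c then 0 else s I b * s (I - {b}) c * \<alpha> b * \<beta> c * u (I - {b, c}))"
      by (simp add: sum_distrib_left if_distrib[of "\<lambda>x. _ * x"] mult_ac cong: if_cong)
    finally show ?thesis .
  qed
  \<comment> \<open>The smaller of the two elements shifts the position of the larger one when it is
    removed first; the larger never shifts the smaller. So exactly one sign flips.\<close>
  have sgn: "s I b * s (I - {b}) c = - (s I c * s (I - {c}) b)" if "b \<in> I" "c \<in> I" "b \<noteq> c" for b c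
    unfolding s_def sign_remove[OF True \<open>b \<in> I\<close>] sign_remove[OF True \<open>c \<in> I\<close>]
    using \<open>b \<noteq> c\<close> by (cases "b < c") auto
  have "wedge1 \<alpha> (wedge1 \<beta> u) I = (\<Sum>c\<in>I. \<Sum>b\<in>I. if b = c then 0
      else s I b * s (I - {b}) c * \<alpha> b * \<beta> c * u (I - {b, c}))"
    unfolding expand by (rule sum.swap)
  also have "\<dots> = (\<Sum>c\<in>I. \<Sum>b\<in>I. - (if c = b then 0
      else s I c * s (I - {c}) b * \<beta> c * \<alpha> b * u (I - {c, b})))"
  proof (intro sum.cong refl, goal_cases)
    case (1 c b)
    then show ?case using sgn[of b c] by (cases "b = c") (simp_all add: insert_commute[of b c "{}"])
  qed
  also have "\<dots> = - wedge1 \<beta> (wedge1 \<alpha> u) I"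
    unfolding expand[of \<beta> \<alpha>] sum_negf ..
  finally show ?thesis .
qed

text \<open>Anticommutation with itself gives x = -x, which forces x = 0 in characteristic
  0.\<close>

lemma wedge1_square:
  fixes \<alpha> :: "'b::linorder \<Rightarrow> 'l::field_char_0"
  shows "wedge1 \<alpha> (wedge1 \<alpha> u) I = 0"
  using wedge1_anticommute[of \<alpha> \<alpha> u I] by simp

lemma wedge1_sum_left:
  "wedge1 (\<lambda>x. \<Sum>i\<in>A. a i * f i x) u J = (\<Sum>i\<in>A. a i * wedge1 (f i) u J)"
  unfolding wedge1_def sum_distrib_left sum_distrib_right
  by (subst sum.swap) (simp add: mult_ac)

lemma wedge1_sum_right:
  "wedge1 \<alpha> (\<lambda>I. \<Sum>i\<in>A. a i * U i I) J = (\<Sum>i\<in>A. a i * wedge1 \<alpha> (U i) J)"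
  unfolding wedge1_def sum_distrib_left sum_distrib_right
  by (subst sum.swap) (simp add: mult_ac)

lemma wedge1_scale_right:
  "wedge1 \<alpha> (\<lambda>I. k * u I) J = k * wedge1 \<alpha> u J"
  by (simp add: wedge1_def sum_distrib_left mult_ac)

lemma wedge1_zero_right: "wedge1 \<alpha> (\<lambda>I. 0) J = 0"
  by (simp add: wedge1_def)

lemma wedge_list_simps [simp]:
  "wedge_list [] = (\<lambda>I. if I = {} then 1 else 0)"
  "wedge_list (\<alpha> # \<alpha>s) = wedge1 \<alpha> (wedge_list \<alpha>s)"
  by (simp_all add: wedge_list_def)

text \<open>The extra factor is moved to the right by anticommutation until it meets its own copy,
  where the square vanishes.\<close>

lemma wedge1_wedge_list_mem:
  fixes t :: "'b::linorder \<Rightarrow> 'b \<Rightarrow> 'l::field_char_0"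
  assumes "b \<in> set xs"
  shows "wedge1 (t b) (wedge_list (map t xs)) J = 0"
  using assms
proof (induction xs arbitrary: J)
  case (Cons x xs)
  show ?case
  proof (cases "b = x")
    case True
    then show ?thesis by (simp add: wedge1_square)
  next
    case False
    then have "wedge1 (t b) (wedge_list (map t xs)) = (\<lambda>J. 0)" using Cons by auto
    then show ?thesis
      by (simp add: wedge1_anticommute[of "t b"] wedge1_zero_right)
  qed
qed simp

text \<open>Sorting the new factor into its place passes the smaller entries one at a time, each at
  the cost of a sign. This is the same sign as in \<open>wedge1\<close>, which makes the two cancel
  in the comparison of bases.\<close>

lemma wedge1_wedge_list_insort:
  assumes "sorted xs" "distinct xs" "b \<notin> set xs"
  shows "wedge1 (t b) (wedge_list (map t xs)) J
    = (-1) ^ card {c \<in> set xs. c < b} * wedge_list (map t (insort b xs)) J"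
  using assms
proof (induction xs arbitrary: J)
  case (Cons x xs)
  show ?case
  proof (cases "b \<le> x")
    case True
    then have "{c \<in> set (x # xs). c < b} = {}" using Cons.prems by auto
    then show ?thesis using True by (simp only: insort_key.simps) simp
  next
    case False
    have "{c \<in> set (x # xs). c < b} = insert x {c \<in> set xs. c < b}" using False by auto
    then have card: "card {c \<in> set (x # xs). c < b} = Suc (card {c \<in> set xs. c < b})"
      using Cons.prems by simp
    have IH: "wedge1 (t b) (wedge_list (map t xs))
      = (\<lambda>J. (-1) ^ card {c \<in> set xs. c < b} * wedge_list (map t (insort b xs)) J)"
      using Cons by auto
    have "wedge1 (t b) (wedge_list (map t (x # xs))) J
      = - wedge1 (t x) (wedge1 (t b) (wedge_list (map t xs))) J"
      by (simp add: wedge1_anticommute[of "t b"])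
    also have "\<dots> = - ((-1) ^ card {c \<in> set xs. c < b} * wedge_list (map t (x # insort b xs)) J)"
      unfolding IH wedge1_scale_right by simp
    finally show ?thesis using False by (simp only: card) simp
  qed
qed simp

section \<open>Induced maps on exterior powers\<close>

lemma ext_basisD:
  assumes "finite B" "I \<in> ext_basis B r"
  shows "finite I" "I \<subseteq> B" "card I = r" "set (sorted_list_of_set I) = I"
proof -
  show "finite I" "I \<subseteq> B" "card I = r"
    using assms finite_subset unfolding ext_basis_def by auto
  then show "set (sorted_list_of_set I) = I" by simp
qed

lemma finite_ext_basis: "finite B \<Longrightarrow> finite (ext_basis B r)"
  unfolding ext_basis_def by auto

text \<open>The inductive core of functoriality: the induced map sends a wedge with
  \<open>\<alpha>\<close> to the wedge with the image of \<open>\<alpha>\<close>. The left side runs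
  over pairs of a set with r + 1 elements and a member of it, the right side over pairs of a set
  with r elements and any basis index; removing the member matches the former with the pairs where
  the index is new.\<close>

lemma ext_map_wedge1:
  fixes t :: "'b::linorder \<Rightarrow> 'b \<Rightarrow> 'l::field_char_0"
  assumes B: "finite B"
  shows "ext_map B (Suc r) t (wedge1 \<alpha> u) J
    = wedge1 (\<lambda>x. \<Sum>b\<in>B. \<alpha> b * t b x) (ext_map B r t u) J"
proof -
  define s where "s I b = (-1 :: 'l) ^ card {c \<in> I. c < b}" for I and b :: 'b
  define w where "w I = wedge_list (map t (sorted_list_of_set I)) J" for I
  have fin: "finite I" "b \<in> I \<Longrightarrow> b \<in> B" if "I \<in> ext_basis B k" for I k b
    using that B finite_subset unfolding ext_basis_def by auto
  have mem: "wedge1 (t b) (wedge_list (map t (sorted_list_of_set I))) J = 0"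
    if "I \<in> ext_basis B r" "b \<in> I" for b I
    using fin(1)[OF that(1)] that(2) by (intro wedge1_wedge_list_mem) simp
  have notmem: "wedge1 (t b) (wedge_list (map t (sorted_list_of_set I))) J
      = s (insert b I) b * w (insert b I)"
    if "I \<in> ext_basis B r" "b \<notin> I" for b I
  proof -
    have "{c \<in> insert b I. c < b} = {c \<in> I. c < b}" by auto
    then show ?thesis
      using fin(1)[OF that(1)] that(2) unfolding w_def s_def
      by (subst wedge1_wedge_list_insort) simp_all
  qed
  have "ext_map B (Suc r) t (wedge1 \<alpha> u) J
      = (\<Sum>I\<in>ext_basis B (Suc r). \<Sum>b\<in>I. s I b * \<alpha> b * u (I - {b}) * w I)"
    by (simp add: ext_map_def wedge1_def s_def w_def sum_distrib_right)
  also have "\<dots> = (\<Sum>(I, b)\<in>Sigma (ext_basis B (Suc r)) (\<lambda>I. I). s I b * \<alpha> b * u (I - {b}) * w I)"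
    using B fin by (subst sum.Sigma) (auto simp: finite_ext_basis)
  also have "\<dots> = (\<Sum>(I, b)\<in>Sigma (ext_basis B r) (\<lambda>I. B - I).
      s (insert b I) b * \<alpha> b * u I * w (insert b I))"
  proof (rule sum.reindex_bij_witness[where i = "\<lambda>(I, b). (insert b I, b)"
          and j = "\<lambda>(I, b). (I - {b}, b)"], goal_cases)
    case (1 a)
    then show ?case by (auto simp: insert_absorb)
  next
    case (2 a)
    then obtain I b where a: "a = (I, b)" "I \<in> ext_basis B (Suc r)" "b \<in> I" by auto
    then have "I - {b} \<in> ext_basis B r"
      using card_Suc_Diff1[OF ext_basisD(1)[OF B a(2)] a(3)] unfolding ext_basis_def by auto
    then show ?case using a ext_basisD(2)[OF B a(2)] by auto
  next
    case (3 a)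
    then show ?case by auto
  next
    case (4 a)
    then obtain I b where a: "a = (I, b)" "I \<in> ext_basis B r" "b \<in> B" "b \<notin> I" by auto
    then have "insert b I \<in> ext_basis B (Suc r)"
      using ext_basisD(1)[OF B a(2)] unfolding ext_basis_def by auto
    then show ?case using a by auto
  next
    case (5 a)
    then show ?case by (auto simp: insert_absorb)
  qed
  also have "\<dots> = (\<Sum>I\<in>ext_basis B r. \<Sum>b\<in>B - I.
      s (insert b I) b * \<alpha> b * u I * w (insert b I))"
    using B by (subst sum.Sigma) (auto simp: finite_ext_basis)
  \<comment> \<open>The indices \<open>b\<close> in \<open>I\<close> may be added freely, since
    wedging with a repeated factor gives 0 by \<open>mem\<close>; for new \<open>b\<close>,
    \<open>notmem\<close> turns the sign and the enlarged set into a wedge.\<close>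
  also have "\<dots> = (\<Sum>I\<in>ext_basis B r. \<Sum>b\<in>B.
      \<alpha> b * u I * wedge1 (t b) (wedge_list (map t (sorted_list_of_set I))) J)"
    using B by (intro sum.cong refl sum.mono_neutral_cong_left) (auto simp: mem notmem)
  also have "\<dots> = wedge1 (\<lambda>x. \<Sum>b\<in>B. \<alpha> b * t b x) (ext_map B r t u) J"
    unfolding ext_map_def wedge1_sum_left wedge1_sum_right sum_distrib_left
    by (subst sum.swap) (simp add: mult_ac)
  finally show ?thesis .
qed

lemma ext_basis_0: "finite B \<Longrightarrow> ext_basis B 0 = {{}}"
  unfolding ext_basis_def using finite_subset by fastforce

lemma ext_map_wedge_list:
  fixes t :: "'b::linorder \<Rightarrow> 'b \<Rightarrow> 'l::field_char_0"
  assumes B: "finite B"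
  shows "ext_map B (length \<alpha>s) t (wedge_list \<alpha>s)
    = wedge_list (map (\<lambda>\<alpha> x. \<Sum>b\<in>B. \<alpha> b * t b x) \<alpha>s)"
proof (induction \<alpha>s)
  case Nil
  show ?case by (simp add: ext_map_def ext_basis_0[OF B])
next
  case (Cons \<alpha> \<alpha>s)
  show ?case by (rule ext) (simp add: ext_map_wedge1[OF B] Cons.IH)
qed

lemma ext_map_sum:
  "ext_map B r t (\<lambda>I. \<Sum>i\<in>A. a i * U i I) J = (\<Sum>i\<in>A. a i * ext_map B r t (U i) J)"
  unfolding ext_map_def sum_distrib_left sum_distrib_right
  by (subst sum.swap) (simp add: mult_ac)

text \<open>By linearity it suffices to treat the images of basis vectors. These are wedges of
  one-forms, on which \<open>ext_map_wedge_list\<close> applies the outer map factor by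
  factor.\<close>

lemma ext_map_compose:
  fixes s t :: "'b::linorder \<Rightarrow> 'b \<Rightarrow> 'l::field_char_0"
  assumes B: "finite B"
  shows "ext_map B r s (ext_map B r t u) = ext_map B r (\<lambda>b x. \<Sum>c\<in>B. t b c * s c x) u"
proof
  fix J
  have *: "ext_map B r s (wedge_list (map t (sorted_list_of_set I))) J
      = wedge_list (map (\<lambda>b x. \<Sum>c\<in>B. t b c * s c x) (sorted_list_of_set I)) J"
    if "I \<in> ext_basis B r" for I
  proof -
    have "length (map t (sorted_list_of_set I)) = r"
      using that unfolding ext_basis_def by simp
    from ext_map_wedge_list[OF B, of "map t (sorted_list_of_set I)" s, unfolded this]
    show ?thesis by (simp add: comp_def)
  qed
  have "ext_map B r s (ext_map B r t u) J =
    (\<Sum>I\<in>ext_basis B r. u I * ext_map B r s (wedge_list (map t (sorted_list_of_set I))) J)"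
    unfolding ext_map_def[of B r t] by (rule ext_map_sum)
  also have "\<dots> = ext_map B r (\<lambda>b x. \<Sum>c\<in>B. t b c * s c x) u J"
    unfolding ext_map_def[of B r "\<lambda>b x. \<Sum>c\<in>B. t b c * s c x"] by (simp add: *)
  finally show "ext_map B r s (ext_map B r t u) J = ext_map B r (\<lambda>b x. \<Sum>c\<in>B. t b c * s c x) u J" .
qed

lemma ext_map_cong:
  assumes "finite B" "\<And>b. b \<in> B \<Longrightarrow> t b = t' b"
  shows "ext_map B r t = ext_map B r t'"
proof -
  have "map t (sorted_list_of_set I) = map t' (sorted_list_of_set I)" if "I \<in> ext_basis B r" for I
    using assms(2) ext_basisD(2,4)[OF assms(1) that] by (intro map_cong refl) auto
  then show ?thesis unfolding ext_map_def by (intro ext sum.cong refl arg_cong2[of _ _ _ _ "\<lambda>x y. x * wedge_list y _"])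
qed

lemma wedge_list_indicator:
  fixes xs :: "'b::linorder list"
  assumes "sorted xs" "distinct xs"
  shows "wedge_list (map (\<lambda>b c. if c = b then 1 else 0) xs) J = (if J = set xs then 1 else 0 :: 'l::field)"
  using assms
proof (induction xs arbitrary: J)
  case (Cons x xs)
  let ?e = "\<lambda>b c. if c = b then 1 else (0 :: 'l)"
  have IH: "wedge_list (map ?e xs) = (\<lambda>J. if J = set xs then 1 else 0)"
    using Cons by auto
  have eq: "wedge_list (map ?e (x # xs)) J
    = (\<Sum>b\<in>J. if b = x then (-1) ^ card {c \<in> J. c < x} * (if J - {x} = set xs then 1 else 0) else 0)"
    unfolding list.map wedge_list_simps wedge1_def IH by (intro sum.cong) auto
  show ?case
  proof (cases "J = set (x # xs)")
    case True
    \<comment> \<open>\<open>x\<close> is the least element of the sorted list, so its removal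
      carries no sign.\<close>
    then have empty: "{c \<in> J. c < x} = {}" and "J - {x} = set xs" "finite J" "x \<in> J"
      using Cons.prems by auto
    then show ?thesis unfolding eq empty using True by simp
  next
    case False
    then have "J - {x} \<noteq> set xs \<or> x \<notin> J" by auto
    then have "wedge_list (map ?e (x # xs)) J = 0"
      unfolding eq by (intro sum.neutral) auto
    then show ?thesis using False by simp
  qed
qed simp

lemma ext_map_indicator:
  assumes B: "finite B" and u: "u \<in> coord_space (ext_basis B r)"
  shows "ext_map B r (\<lambda>b c. if c = b then 1 else 0) u = u"
proof
  fix J
  have "ext_map B r (\<lambda>b c. if c = b then 1 else 0) u J
    = (\<Sum>I\<in>ext_basis B r. if I = J then u I else 0)"
    unfolding ext_map_def
  proof (intro sum.cong refl)
    fix I assume "I \<in> ext_basis B r"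
    then have "finite I" using B finite_subset unfolding ext_basis_def by auto
    then show "u I * wedge_list (map (\<lambda>b c. if c = b then 1 else 0) (sorted_list_of_set I)) J
      = (if I = J then u I else 0)"
      by (subst wedge_list_indicator) auto
  qed
  also have "\<dots> = u J"
    using u finite_ext_basis[OF B] by (auto simp: coord_space_def)
  finally show "ext_map B r (\<lambda>b c. if c = b then 1 else 0) u J = u J" .
qed

text \<open>Each factor contributes one index, and only indices in \<open>B\<close> have a nonzero
  coefficient; hence a nonzero coefficient at \<open>J\<close> forces \<open>J\<close> to lie in
  \<open>B\<close> and to have as many elements as there are factors.\<close>

lemma wedge_list_support:
  assumes "\<And>\<alpha>. \<alpha> \<in> set \<alpha>s \<Longrightarrow> \<alpha> \<in> coord_space B" and "J \<notin> ext_basis B (length \<alpha>s)"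
  shows "wedge_list \<alpha>s J = 0"
  using assms
proof (induction \<alpha>s arbitrary: J)
  case Nil
  then show ?case by (auto simp: ext_basis_def)
next
  case (Cons \<alpha> \<alpha>s)
  show ?case
  proof (cases "finite J")
    case True
    have "\<alpha> b * wedge_list \<alpha>s (J - {b}) = 0" if "b \<in> J" for b
    proof (cases "b \<in> B")
      case True
      have "J - {b} \<notin> ext_basis B (length \<alpha>s)"
      proof
        assume "J - {b} \<in> ext_basis B (length \<alpha>s)"
        then have "J \<in> ext_basis B (length (\<alpha> # \<alpha>s))"
          using card_Suc_Diff1[OF \<open>finite J\<close> \<open>b \<in> J\<close>] True unfolding ext_basis_def by auto
        then show False using Cons.prems by simp
      qed
      then show ?thesis using Cons by simp
    next
      case False
      then show ?thesis using Cons.prems(1)[of \<alpha>] by (simp add: coord_space_def)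
    qed
    then show ?thesis by (auto simp: wedge1_def mult.assoc intro: sum.neutral)
  qed (simp add: wedge1_def)
qed

lemma ext_map_coord_space:
  assumes B: "finite B" and t: "\<And>b. b \<in> B \<Longrightarrow> t b \<in> coord_space B"
  shows "ext_map B r t u \<in> coord_space (ext_basis B r)"
proof -
  have "wedge_list (map t (sorted_list_of_set I)) J = 0"
    if "I \<in> ext_basis B r" "J \<notin> ext_basis B r" for I J
  proof -
    have "length (map t (sorted_list_of_set I)) = r"
      using that unfolding ext_basis_def by simp
    then show ?thesis
      using that t ext_basisD(2,4)[OF B that(1)] by (intro wedge_list_support[where B = B]) auto
  qed
  then show ?thesis by (auto simp: coord_space_def ext_map_def intro!: sum.neutral)
qed

section \<open>Polynomial dependence of the coefficients\<close>

lemma subfield_zero: "is_subfield K \<Longrightarrow> 0 \<in> K"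
  unfolding is_subfield_def by (metis diff_self)

lemma poly_fun_sum:
  assumes "0 \<in> K" "\<And>i. i \<in> A \<Longrightarrow> f i \<in> poly_fun K n"
  shows "(\<lambda>Z. \<Sum>i\<in>A. f i Z) \<in> poly_fun K n"
  using assms(2)
  by (induction A rule: infinite_finite_induct) (auto intro: poly_fun.intros assms(1))

text \<open>Unfolding one factor at a time writes the coefficient as a signed sum of products of the
  \<open>t h b c\<close>. The index set \<open>J\<close> stays fixed, so each sum is over a set
  independent of \<open>h\<close>.\<close>

lemma poly_fun_wedge_list:
  assumes K: "is_subfield K" and t: "\<And>b c. b \<in> set xs \<Longrightarrow> (\<lambda>h. t h b c) \<in> poly_fun K n"
  shows "(\<lambda>h. wedge_list (map (t h) xs) J) \<in> poly_fun K n"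
  using t
proof (induction xs arbitrary: J)
  have 0: "0 \<in> K" and 1: "1 \<in> K" using K subfield_zero by (auto simp: is_subfield_def)
  have "-1 \<in> K" using 0 1 K unfolding is_subfield_def by (metis diff_0)
  then have sgn: "(-1) ^ k \<in> K" for k
    by (cases "even k") (auto simp: 1)
  {
    case Nil
    then show ?case using 0 1 by (auto intro: poly_fun.const)
  next
    case (Cons x xs)
    then show ?case
      by (auto simp: wedge1_def intro!: poly_fun_sum 0 poly_fun.mult poly_fun.const sgn)
  }
qed

section \<open>The representation \<open>\<sigma>\<^sub>r\<close>\<close>

lemma finite_idx: "finite (idx n)"
  by (rule finite_subset[of _ "{..<n} \<times> {..<n}"]) (auto simp: idx_def)

lemma index_mult_sum:
  assumes "A \<in> carrier_mat n n" "B \<in> carrier_mat n n" "i < n" "j < n"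
  shows "(A * B) $$ (i, j) = (\<Sum>k<n. A $$ (i, k) * B $$ (k, j))"
  using assms by (simp add: scalar_prod_def atLeast0LessThan)

lemma index_mult3:
  assumes "A \<in> carrier_mat n n" "M \<in> carrier_mat n n" "B \<in> carrier_mat n n" "i < n" "j < n"
  shows "(A * M * B) $$ (i, j) = (\<Sum>l<n. \<Sum>k<n. A $$ (i, k) * M $$ (k, l) * B $$ (l, j))"
  unfolding index_mult_sum[OF mult_carrier_mat[OF assms(1,2)] assms(3-5)] sum_distrib_right[symmetric]
  using assms by (intro sum.cong refl) (simp add: index_mult_sum del: index_mult_mat)

lemma form_to_sym_carrier [simp]: "form_to_sym n w \<in> carrier_mat n n"
  by (simp add: form_to_sym_def)

lemma form_to_sym_sum:
  assumes "i < n" "j < n"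
  shows "form_to_sym n (\<lambda>x. \<Sum>b\<in>A. a b * f b x) $$ (i, j) = (\<Sum>b\<in>A. a b * form_to_sym n (f b) $$ (i, j))"
  using assms by (auto simp: form_to_sym_def sum_divide_distrib)

text \<open>Off the diagonal \<open>sym_to_form\<close> adds the entries at (i, j) and (j, i), which
  yields the two products; on the diagonal there is only one. The coefficient is thereby symmetric
  in \<open>k\<close> and \<open>l\<close>.\<close>

lemma sigma1_apply:
  assumes "h \<in> carrier_mat n n" "(i, j) \<in> idx n"
  shows "sigma1 n h w (i, j) = (\<Sum>l<n. \<Sum>k<n.
    (if i = j then h $$ (i, k) * h $$ (i, l) else h $$ (i, k) * h $$ (j, l) + h $$ (j, k) * h $$ (i, l))
    * form_to_sym n w $$ (k, l))"
proof -
  have ij: "i < n" "j < n" using assms(2) by (auto simp: idx_def)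
  let ?S = "form_to_sym n w"
  have entry: "(h * ?S * transpose_mat h) $$ (i, j)
    = (\<Sum>l<n. \<Sum>k<n. h $$ (i, k) * ?S $$ (k, l) * h $$ (j, l))" if "i < n" "j < n" for i j
    using assms(1) that by (subst index_mult3[of _ n]) (auto intro!: sum.cong)
  show ?thesis
  proof (cases "i = j")
    case True
    then have "sigma1 n h w (i, j) = (h * ?S * transpose_mat h) $$ (i, i)"
      using assms(2) by (simp add: sigma1_def sym_to_form_def)
    then show ?thesis using True ij by (simp only: entry) (simp add: mult_ac)
  next
    case False
    then have "sigma1 n h w (i, j) = (h * ?S * transpose_mat h) $$ (i, j) + (h * ?S * transpose_mat h) $$ (j, i)"
      using assms(2) by (simp add: sigma1_def sym_to_form_def)
    then show ?thesis using False ij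
      by (simp only: entry if_False simp_thms flip: sum.distrib) (simp add: algebra_simps)
  qed
qed

lemma sigma1_outside: "c \<notin> idx n \<Longrightarrow> sigma1 n h w c = 0"
  by (auto simp: sigma1_def sym_to_form_def split: prod.splits)

lemma sigma1_coord_space: "sigma1 n h w \<in> coord_space (idx n)"
  by (simp add: coord_space_def sigma1_outside)

lemma sigma1_sum:
  assumes h: "h \<in> carrier_mat n n"
  shows "sigma1 n h (\<lambda>x. \<Sum>b\<in>A. a b * f b x) c = (\<Sum>b\<in>A. a b * sigma1 n h (f b) c)"
proof (cases "c \<in> idx n")
  case True
  then obtain i j where c: "c = (i, j)" "(i, j) \<in> idx n" by (cases c) auto
  define m where "m k l = (if i = j then h $$ (i, k) * h $$ (i, l)
    else h $$ (i, k) * h $$ (j, l) + h $$ (j, k) * h $$ (i, l))" for k l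
  have "sigma1 n h (\<lambda>x. \<Sum>b\<in>A. a b * f b x) c
    = (\<Sum>l<n. \<Sum>k<n. \<Sum>b\<in>A. a b * (m k l * form_to_sym n (f b) $$ (k, l)))"
    unfolding c(1) sigma1_apply[OF h c(2)] m_def[symmetric]
    by (intro sum.cong refl) (simp add: form_to_sym_sum sum_distrib_left mult_ac)
  also have "\<dots> = (\<Sum>l<n. \<Sum>b\<in>A. \<Sum>k<n. a b * (m k l * form_to_sym n (f b) $$ (k, l)))"
    by (intro sum.cong refl sum.swap)
  also have "\<dots> = (\<Sum>b\<in>A. \<Sum>l<n. \<Sum>k<n. a b * (m k l * form_to_sym n (f b) $$ (k, l)))"
    by (rule sum.swap)
  also have "\<dots> = (\<Sum>b\<in>A. a b * sigma1 n h (f b) c)"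
    unfolding c(1) sigma1_apply[OF h c(2)] m_def[symmetric] by (simp add: sum_distrib_left)
  finally show ?thesis .
qed (simp add: sigma1_outside)

lemma sigma1_basis_expansion:
  assumes h: "h \<in> carrier_mat n n" and w: "w \<in> coord_space (idx n)"
  shows "sigma1 n h w c = (\<Sum>b\<in>idx n. w b * sigma1 n h (\<lambda>x. if x = b then 1 else 0) c)"
proof -
  have "w = (\<lambda>x. \<Sum>b\<in>idx n. w b * (if x = b then 1 else 0))"
    using w finite_idx[of n] by (auto simp: coord_space_def if_distrib[of "\<lambda>y. _ * y"] cong: if_cong)
  then have "sigma1 n h w c = sigma1 n h (\<lambda>x. \<Sum>b\<in>idx n. w b * (if x = b then 1 else 0)) c"
    by simp
  then show ?thesis unfolding sigma1_sum[OF h] .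
qed

text \<open>For symmetric \<open>S\<close> the off-diagonal entries are doubled and then halved;
  characteristic 0 makes 2 invertible.\<close>

lemma form_to_sym_sym_to_form:
  fixes S :: "'l::field_char_0 mat"
  assumes S: "S \<in> carrier_mat n n" "transpose_mat S = S"
  shows "form_to_sym n (sym_to_form n S) = S"
proof -
  have sym: "S $$ (j, i) = S $$ (i, j)" if "i < n" "j < n" for i j
    using S that by (metis carrier_matD index_transpose_mat(1))
  show ?thesis
    using S(1) by (intro eq_matI)
      (auto simp: form_to_sym_def sym_to_form_def idx_def min_def max_def sym)
qed

lemma sym_to_form_form_to_sym:
  fixes w :: "nat \<times> nat \<Rightarrow> 'l::field_char_0"
  assumes "w \<in> coord_space (idx n)"
  shows "sym_to_form n (form_to_sym n w) = w"
  using assms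
  by (auto simp: fun_eq_iff form_to_sym_def sym_to_form_def idx_def coord_space_def min_def max_def)

lemma transpose_form_to_sym: "transpose_mat (form_to_sym n w) = form_to_sym n w"
  by (rule eq_matI) (auto simp: form_to_sym_def min.commute max.commute)

text \<open>In symmetric coordinates the action is the congruence by \<open>h\<close>, and
  congruences compose. Since the congruence keeps the matrix symmetric, passing through coordinates
  of forms between the two factors loses nothing.\<close>

lemma sigma1_mult:
  fixes g h :: "'l::field_char_0 mat"
  assumes g: "g \<in> carrier_mat n n" and h: "h \<in> carrier_mat n n"
  shows "sigma1 n (g * h) w = sigma1 n g (sigma1 n h w)"
proof -
  define S where "S = form_to_sym n w"
  have S: "S \<in> carrier_mat n n" "transpose_mat S = S"
    by (simp_all add: S_def transpose_form_to_sym)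
  have c: "h * S * transpose_mat h \<in> carrier_mat n n" using h S by simp
  have "transpose_mat (h * S * transpose_mat h) = h * S * transpose_mat h"
    using h S by (simp add: transpose_mult[of _ n n _ n])
  then have "sigma1 n g (sigma1 n h w) = sym_to_form n (g * (h * S * transpose_mat h) * transpose_mat g)"
    unfolding sigma1_def S_def[symmetric] using c by (simp add: form_to_sym_sym_to_form)
  also have "g * (h * S * transpose_mat h) * transpose_mat g = (g * h) * S * transpose_mat (g * h)"
    using g h S by (simp add: transpose_mult[of _ n n _ n] assoc_mult_mat[of _ n n _ n _ n])
  finally show ?thesis unfolding sigma1_def S_def by simp
qed

lemma sigma1_one:
  fixes w :: "nat \<times> nat \<Rightarrow> 'l::field_char_0"
  assumes "w \<in> coord_space (idx n)"
  shows "sigma1 n (1\<^sub>m n) w = w"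
  using assms by (simp add: sigma1_def sym_to_form_form_to_sym
      left_mult_one_mat[of _ n n] right_mult_one_mat[of _ n n])

text \<open>
  \<open>sigma1_coeff n h b c\<close> is the coefficient of \<open>dZ\<^sub>c\<close> in \<open>\<sigma>\<^sub>1(h) dZ\<^sub>b\<close>, read off from
  \<open>\<sigma>\<^sub>1(h) dZ = \<^sup>th dZ h\<close>.
\<close>

definition sigma1_coeff :: "nat \<Rightarrow> 'l::field mat \<Rightarrow> nat \<times> nat \<Rightarrow> nat \<times> nat \<Rightarrow> 'l" where
  "sigma1_coeff n h = (\<lambda>(k, l) (i, j). if (i, j) \<in> idx n
     then if i = j then h $$ (i, k) * h $$ (i, l)
       else h $$ (i, k) * h $$ (j, l) + h $$ (i, l) * h $$ (j, k)
     else 0)"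

lemma sigma1_basis:
  fixes h :: "'l::field_char_0 mat"
  assumes h: "h \<in> carrier_mat n n" and b: "b \<in> idx n"
  shows "sigma1 n h (\<lambda>c. if c = b then 1 else 0) = sigma1_coeff n h b"
proof
  fix c
  obtain p q where pq: "b = (p, q)" "p \<le> q" "q < n" using b by (auto simp: idx_def)
  show "sigma1 n h (\<lambda>c. if c = b then 1 else 0) c = sigma1_coeff n h b c"
  proof (cases "c \<in> idx n")
    case True
    then obtain i j where c: "c = (i, j)" "(i, j) \<in> idx n" by (cases c) auto
    define m where "m k l = (if i = j then h $$ (i, k) * h $$ (i, l)
      else h $$ (i, k) * h $$ (j, l) + h $$ (j, k) * h $$ (i, l))" for k l
    \<comment> \<open>Written as a sum of two halves, the matrix needs no case distinction: for p =
      q the halves add up to 1 at one place.\<close>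
    have "form_to_sym n (\<lambda>c. if c = b then 1 else 0) $$ (k, l)
      = (if k = p then if l = q then 1 / 2 else 0 else 0) + (if k = q then if l = p then 1 / 2 else 0 else (0 :: 'l))"
      if "k < n" "l < n" for k l
      using that pq by (auto simp: form_to_sym_def min_def max_def)
    then have "sigma1 n h (\<lambda>c. if c = b then 1 else 0) c = (\<Sum>l<n. \<Sum>k<n.
       m k l * (if k = p then if l = q then 1 / 2 else 0 else 0) +
       m k l * (if k = q then if l = p then 1 / 2 else 0 else 0))"
      unfolding c(1) sigma1_apply[OF h c(2)] m_def[symmetric]
      by (intro sum.cong refl) (simp only: lessThan_iff distrib_left)
    also have "\<dots> = m p q / 2 + m q p / 2"
      using pq by (simp add: sum.distrib if_distrib[of "\<lambda>x. _ * x"] cong: if_cong)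
    \<comment> \<open>\<open>m\<close> is symmetric in its two arguments, so the two halves make one
      full coefficient.\<close>
    also have "\<dots> = sigma1_coeff n h b c"
      using c by (auto simp: m_def sigma1_coeff_def pq(1) mult_ac field_simps)
    finally show ?thesis .
  next
    case False
    then show ?thesis using sigma1_outside[OF False] by (auto simp: sigma1_coeff_def split: prod.splits)
  qed
qed

section \<open>From one-forms to r-forms\<close>

lemma sigma_r_coeff:
  fixes h :: "'l::field_char_0 mat"
  assumes "h \<in> carrier_mat n n"
  shows "sigma_r n r h = ext_map (idx n) r (sigma1_coeff n h)"
  unfolding sigma_r_def ext_power_def
  using assms by (intro ext_map_cong finite_idx) (simp add: sigma1_basis)

lemma sigma_r_mult:
  fixes g h :: "'l::field_char_0 mat"
  assumes g: "g \<in> carrier_mat n n" and h: "h \<in> carrier_mat n n"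
  shows "sigma_r n r (g * h) u = sigma_r n r g (sigma_r n r h u)"
  unfolding sigma_r_def ext_power_def ext_map_compose[OF finite_idx]
  by (simp only: sigma1_mult[OF g h] sigma1_basis_expansion[OF g sigma1_coord_space, symmetric])

lemma sigma_r_one:
  fixes u :: "(nat \<times> nat) set \<Rightarrow> 'l::field_char_0"
  assumes "u \<in> coord_space (ext_basis (idx n) r)"
  shows "sigma_r n r (1\<^sub>m n) u = u"
proof -
  have "sigma_r n r (1\<^sub>m n) u = ext_map (idx n) r (\<lambda>b c. if c = b then 1 else (0 :: 'l)) u"
    unfolding sigma_r_def ext_power_def
    by (rule fun_cong[OF ext_map_cong[OF finite_idx]]) (intro sigma1_one, auto simp: coord_space_def)
  then show ?thesis using assms by (simp add: ext_map_indicator finite_idx)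
qed

lemma sigma_r_coord_space: "sigma_r n r h u \<in> coord_space (ext_basis (idx n) r)"
  for h :: "'l::field_char_0 mat"
  unfolding sigma_r_def ext_power_def by (intro ext_map_coord_space finite_idx sigma1_coord_space)

lemma poly_fun_sigma1_coeff:
  assumes "is_subfield K" "b \<in> idx n"
  shows "(\<lambda>h. sigma1_coeff n h b c) \<in> poly_fun K n"
proof (cases "c \<in> idx n")
  case True
  then show ?thesis
    using assms(2) by (cases b; cases c; cases "fst c = snd c")
      (auto simp: sigma1_coeff_def idx_def intro!: poly_fun.intros)
next
  case False
  then show ?thesis
    using subfield_zero[OF assms(1)]
    by (cases b; cases c) (auto simp: sigma1_coeff_def intro: poly_fun.const)
qed

lemma GL_carrier: "h \<in> GL n R \<Longrightarrow> h \<in> carrier_mat n n"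
  by (simp add: GL_def mats_over_def)

text \<open>The matrix of \<open>sigma_r n r h\<close> consists of r by r minors of the matrix of
  \<open>sigma1 n h\<close>. These are already polynomials in the entries of \<open>h\<close>, so
  the exponent of the determinant is taken to be 0.\<close>

lemma K_rational_rep_sigma_r:
  fixes K :: "'l::field_char_0 set"
  assumes K: "is_subfield K"
  shows "K_rational_rep F K n (ext_basis (idx n) r) (sigma_r n r)"
proof -
  let ?B = "ext_basis (idx n) r"
  define P where "P a b h = wedge_list (map (sigma1_coeff n h) (sorted_list_of_set b)) a"
    for a b and h :: "'l mat"
  have P: "P a b \<in> poly_fun K n" if "b \<in> ?B" for a b
    unfolding P_def using ext_basisD(2,4)[OF finite_idx that]
    by (intro poly_fun_wedge_list[OF K] poly_fun_sigma1_coeff[OF K]) auto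
  have "sigma_r n r h w = (\<lambda>a. if a \<in> ?B then \<Sum>b\<in>?B. P a b h / det h ^ 0 * w b else 0)"
    if "h \<in> GL n UNIV" for h w
  proof
    fix a
    show "sigma_r n r h w a = (if a \<in> ?B then \<Sum>b\<in>?B. P a b h / det h ^ 0 * w b else 0)"
    proof (cases "a \<in> ?B")
      case True
      then show ?thesis
        unfolding sigma_r_coeff[OF GL_carrier[OF that]] ext_map_def P_def by (simp add: mult.commute)
    next
      case False
      then show ?thesis using sigma_r_coord_space[of n r h w] by (simp add: coord_space_def)
    qed
  qed
  then show ?thesis
    unfolding K_rational_rep_def using P
    by (intro conjI exI[of _ "0::nat"] exI[of _ P])
      (auto simp: finite_ext_basis finite_idx sigma_r_one sigma_r_mult GL_carrier)
qed

section \<open>The action of the symplectic group\<close>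

lemma minv:
  fixes A :: "'l::field mat"
  assumes A: "A \<in> carrier_mat n n" and "det A \<noteq> 0"
  shows "minv A \<in> carrier_mat n n" "A * minv A = 1\<^sub>m n" "minv A * A = 1\<^sub>m n"
proof -
  obtain B where B: "mat_inverse A = Some B"
    using mat_inverse(1)[OF A] det_non_zero_imp_unit[OF assms] by fastforce
  then show "minv A \<in> carrier_mat n n" "A * minv A = 1\<^sub>m n" "minv A * A = 1\<^sub>m n"
    using mat_inverse(2)[OF A B] by (simp_all add: minv_def)
qed

lemma minv_eqI:
  fixes A :: "'l::field mat"
  assumes A: "A \<in> carrier_mat n n" and B: "B \<in> carrier_mat n n" and AB: "A * B = 1\<^sub>m n"
  shows "minv A = B"
proof -
  have "det A * det B = 1" using det_mult[OF A B] AB by simp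
  then have "det A \<noteq> 0" by auto
  note inv = minv[OF A this]
  have "minv A = minv A * (A * B)" using inv AB by simp
  also have "\<dots> = (minv A * A) * B" using inv(1) A B by (simp add: assoc_mult_mat[of _ n n _ n _ n])
  also have "\<dots> = B" using inv B by simp
  finally show ?thesis .
qed

lemma four_block_mat_inject:
  assumes "A \<in> carrier_mat n n" "B \<in> carrier_mat n n" "C \<in> carrier_mat n n" "D \<in> carrier_mat n n"
    and "A' \<in> carrier_mat n n" "B' \<in> carrier_mat n n" "C' \<in> carrier_mat n n" "D' \<in> carrier_mat n n"
    and eq: "four_block_mat A B C D = four_block_mat A' B' C' D'"
  shows "A = A'" "B = B'" "C = C'" "D = D'"
proof -
  have ij: "four_block_mat A B C D $$ (i, j) = four_block_mat A' B' C' D' $$ (i, j)" for i j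
    by (simp add: eq)
  show "A = A'"
  proof (rule eq_matI)
    fix i j assume "i < dim_row A'" "j < dim_col A'"
    then show "A $$ (i, j) = A' $$ (i, j)" using ij[of i j] assms(1-8) by simp
  qed (use assms(1-8) in auto)
  show "B = B'"
  proof (rule eq_matI)
    fix i j assume "i < dim_row B'" "j < dim_col B'"
    then show "B $$ (i, j) = B' $$ (i, j)" using ij[of i "n + j"] assms(1-8) by simp
  qed (use assms(1-8) in auto)
  show "C = C'"
  proof (rule eq_matI)
    fix i j assume "i < dim_row C'" "j < dim_col C'"
    then show "C $$ (i, j) = C' $$ (i, j)" using ij[of "n + i" j] assms(1-8) by simp
  qed (use assms(1-8) in auto)
  show "D = D'"
  proof (rule eq_matI)
    fix i j assume "i < dim_row D'" "j < dim_col D'"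
    then show "D $$ (i, j) = D' $$ (i, j)" using ij[of "n + i" "n + j"] assms(1-8) by simp
  qed (use assms(1-8) in auto)
qed

lemma uminus_add_mat_eqD:
  fixes M N R :: "'l::ring_1 mat"
  assumes "M \<in> carrier_mat n n" "N \<in> carrier_mat n n" "- M + N = R"
  shows "N = M + R"
  using assms by (intro eq_matI) auto

lemma J_mat_carrier [simp]: "J_mat n \<in> carrier_mat (2 * n) (2 * n)"
  by (simp add: J_mat_def mult_2)

text \<open>These are the blocks of the defining equation, multiplied out. The last relation is the
  transpose of the third; both orientations serve as rewrite rules later.\<close>

lemma symplectic_blocks:
  fixes A B C D :: "'l::field mat"
  assumes c: "A \<in> carrier_mat n n" "B \<in> carrier_mat n n" "C \<in> carrier_mat n n" "D \<in> carrier_mat n n"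
    and J: "transpose_mat (four_block_mat A B C D) * J_mat n * four_block_mat A B C D = J_mat n"
  shows "transpose_mat A * C = transpose_mat C * A" "transpose_mat B * D = transpose_mat D * B"
    "transpose_mat A * D = transpose_mat C * B + 1\<^sub>m n"
    "transpose_mat D * A = transpose_mat B * C + 1\<^sub>m n"
proof -
  let ?t = transpose_mat
  have t: "?t A \<in> carrier_mat n n" "?t B \<in> carrier_mat n n" "?t C \<in> carrier_mat n n" "?t D \<in> carrier_mat n n"
    using c by simp_all
  have "?t (four_block_mat A B C D) = four_block_mat (?t A) (?t C) (?t B) (?t D)"
    by (rule transpose_four_block_mat[OF c])
  then have 1: "?t (four_block_mat A B C D) * J_mat n = four_block_mat (- ?t C) (?t A) (- ?t D) (?t B)"
    unfolding J_mat_def using c t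
    by (simp add: mult_four_block_mat[OF t(1) t(3) t(2) t(4), of _ n _ n])
  have 2: "?t (four_block_mat A B C D) * J_mat n * four_block_mat A B C D
     = four_block_mat (- (?t C * A) + ?t A * C) (- (?t C * B) + ?t A * D)
         (- (?t D * A) + ?t B * C) (- (?t D * B) + ?t B * D)"
    unfolding 1 using c t
    by (subst mult_four_block_mat[of _ n n _ n _ n _ _ n _ n]) auto
  have "- (?t C * A) + ?t A * C = 0\<^sub>m n n" "- (?t C * B) + ?t A * D = 1\<^sub>m n"
    "- (?t D * A) + ?t B * C = - 1\<^sub>m n" "- (?t D * B) + ?t B * D = 0\<^sub>m n n"
    using four_block_mat_inject[where n = n, OF _ _ _ _ _ _ _ _ trans[OF trans[OF 2[symmetric] J] J_mat_def]] c t
    by auto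
  note eqs = this[THEN uminus_add_mat_eqD[of _ n, rotated 2]]
  show "?t A * C = ?t C * A" "?t B * D = ?t D * B" "?t A * D = ?t C * B + 1\<^sub>m n"
    using eqs(1,2,4) c t by simp_all
  have "?t D * A = ?t (?t A * D)" using c by (simp add: transpose_mult[of _ n n _ n])
  also have "\<dots> = ?t B * C + 1\<^sub>m n"
    unfolding \<open>?t A * D = ?t C * B + 1\<^sub>m n\<close> using c
    by (simp add: transpose_add[of _ n n] transpose_mult[of _ n n _ n])
  finally show "?t D * A = ?t B * C + 1\<^sub>m n" .
qed

lemma J_mat_square: "J_mat n * J_mat n = - 1\<^sub>m (2 * n :: nat)" for n
proof -
  have "J_mat n * J_mat n = (four_block_mat (- 1\<^sub>m n) (0\<^sub>m n n) (0\<^sub>m n n) (- 1\<^sub>m n) :: 'a::field mat)"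
    unfolding J_mat_def by (subst mult_four_block_mat[of _ n n _ n _ n _ _ n _ n]) auto
  also have "\<dots> = - 1\<^sub>m (2 * n)" by (rule eq_matI) auto
  finally show ?thesis .
qed

text \<open>The defining equation and J * J = -1 exhibit the negative of J * tg * J as a left
  inverse of \<open>g\<close>. For square matrices it is then a right inverse, and multiplying by J
  gives the claim. It provides the block relations among the rows of \<open>g\<close>, needed for
  the action on pairs.\<close>

lemma symplectic_transpose:
  fixes g :: "'l::field mat"
  assumes g: "g \<in> carrier_mat (2 * n) (2 * n)" and J: "transpose_mat g * J_mat n * g = J_mat n"
  shows "g * J_mat n * transpose_mat g = J_mat n"
proof -
  let ?N = "2 * n" and ?J = "J_mat n :: 'l mat" and ?t = "transpose_mat g"
  note assoc = assoc_mult_mat[of _ ?N ?N _ ?N _ ?N]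
  have c: "?J \<in> carrier_mat ?N ?N" "?t \<in> carrier_mat ?N ?N" using g by simp_all
  have "(- (?J * ?t * ?J)) * g = - (?J * (?t * ?J * g))"
    using g c carrier_matD[OF g] by (simp add: assoc carrier_matD[OF J_mat_carrier])
  also have "\<dots> = 1\<^sub>m ?N" unfolding J J_mat_square by simp
  finally have left: "(- (?J * ?t * ?J)) * g = 1\<^sub>m ?N" .
  have "- (?J * ?t * ?J) \<in> carrier_mat ?N ?N"
    using c by (simp add: mult_carrier_mat[of _ ?N ?N _ ?N])
  from mat_mult_left_right_inverse[OF this g left]
  have "g * (- (?J * ?t * ?J)) = 1\<^sub>m ?N" .
  then have "- (g * ?J * ?t * ?J) = 1\<^sub>m ?N"
    using g c carrier_matD[OF g]
    by (simp add: assoc mult_carrier_mat[of _ ?N ?N _ ?N] carrier_matD[OF J_mat_carrier])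
  then have eq: "g * ?J * ?t * ?J = - 1\<^sub>m ?N" by (metis uminus_uminus_mat)
  have "g * ?J * ?t * (?J * ?J) = (g * ?J * ?t * ?J) * ?J"
    using g c by (simp add: assoc mult_carrier_mat[of _ ?N ?N _ ?N])
  then show ?thesis unfolding eq J_mat_square
    using g c carrier_matD[OF g]
    by (simp add: assoc carrier_matD[OF J_mat_carrier] left_mult_one_mat[of _ ?N ?N] right_mult_one_mat[of _ ?N ?N]
        mult_carrier_mat[of _ ?N ?N _ ?N])
qed


lemma mat_add_left_commute:
  fixes A :: "'l::ab_semigroup_add mat"
  assumes "A \<in> carrier_mat n n" "B \<in> carrier_mat n n" "C \<in> carrier_mat n n"
  shows "A + (B + C) = B + (A + C)"
  using assms by (intro eq_matI) (auto simp: ac_simps)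

lemma mat_add_diff_cancel:
  fixes A :: "'l::ab_group_add mat"
  assumes "A \<in> carrier_mat n n" "B \<in> carrier_mat n n"
  shows "A + B - A = B"
  using assms by (intro eq_matI) auto

text \<open>After expansion the two sides agree term by term except for two places: tD A W exceeds
  tB C W by W, and Z tA D exceeds Z tC B by Z. The added \<open>Z\<close> and \<open>W\<close>
  balance this without any subtraction, so ordered rewriting of sums suffices.\<close>

lemma moebius_numerator_identity:
  fixes A B C D :: "'l::field mat"
  assumes c: "A \<in> carrier_mat n n" "B \<in> carrier_mat n n" "C \<in> carrier_mat n n" "D \<in> carrier_mat n n"
    and AC: "transpose_mat A * C = transpose_mat C * A"
    and BD: "transpose_mat B * D = transpose_mat D * B"
    and AD: "transpose_mat A * D = transpose_mat C * B + 1\<^sub>m n"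
    and DA: "transpose_mat D * A = transpose_mat B * C + 1\<^sub>m n"
    and Z: "Z \<in> sym_mats n" and W: "W \<in> sym_mats n"
  shows "transpose_mat (C * Z + D) * (A * W + B) + Z = transpose_mat (A * Z + B) * (C * W + D) + W"
proof -
  have Zc: "Z \<in> carrier_mat n n" "transpose_mat Z = Z" and Wc: "W \<in> carrier_mat n n"
    using Z W by (auto simp: sym_mats_def)
  let ?t = transpose_mat
  have t: "?t A \<in> carrier_mat n n" "?t B \<in> carrier_mat n n" "?t C \<in> carrier_mat n n" "?t D \<in> carrier_mat n n"
    using c by simp_all
  note rules = transpose_add[of _ n n] transpose_mult[of _ n n _ n] assoc_mult_mat[of _ n n _ n _ n]
    add_mult_distrib_mat[of _ n n _ _ n] mult_add_distrib_mat[of _ n n _ n]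
    mult_carrier_mat[of _ n n _ n] add_carrier_mat[of _ n n] assoc_add_mat[of _ n n]
    comm_add_mat[of _ n n] mat_add_left_commute[of _ n]
  have assoc: "P * (Q * R) = (P * Q) * R"
    if "P \<in> carrier_mat n n" "Q \<in> carrier_mat n n" "R \<in> carrier_mat n n" for P Q R :: "'l mat"
    using that by simp
  \<comment> \<open>Products are normalised to the right, so each relation is also needed with a
    further factor \<open>R\<close> behind it.\<close>
  have AC': "?t A * (C * R) = ?t C * (A * R)" if "R \<in> carrier_mat n n" for R
    using that c t by (simp only: assoc AC)
  have DA': "?t D * (A * R) = ?t B * (C * R) + R" if "R \<in> carrier_mat n n" for R
  proof -
    have "?t D * (A * R) = (?t B * C + 1\<^sub>m n) * R" using that c t by (simp only: assoc DA)
    also have "\<dots> = ?t B * (C * R) + R" using that c t by (simp add: rules)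
    finally show ?thesis .
  qed
  show ?thesis
    using c t Zc Wc by (simp add: rules AC' DA' BD AD)
qed

lemma moebius_block:
  assumes "A \<in> carrier_mat n n" "B \<in> carrier_mat n n" "C \<in> carrier_mat n n" "D \<in> carrier_mat n n"
  shows "moebius n (four_block_mat A B C D) Z = (A * Z + B) * minv (C * Z + D)"
    "jfac n (four_block_mat A B C D) Z = C * Z + D"
proof -
  have "split_block (four_block_mat A B C D) n n = (A, B, C, D)"
    using assms by (auto simp: split_block_def intro!: eq_matI)
  then show "moebius n (four_block_mat A B C D) Z = (A * Z + B) * minv (C * Z + D)"
    "jfac n (four_block_mat A B C D) Z = C * Z + D"
    by (simp_all add: moebius_def jfac_def)
qed

section \<open>Invariance of the pairs and of the half-space\<close>

lemma subfield_sum: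
  assumes "is_subfield F" "\<And>i. i \<in> A \<Longrightarrow> f i \<in> F"
  shows "sum f A \<in> F"
proof -
  have "0 \<in> F" using assms(1) by (rule subfield_zero)
  moreover have "x + y \<in> F" if "x \<in> F" "y \<in> F" for x y
    using that assms(1) \<open>0 \<in> F\<close> unfolding is_subfield_def by (metis diff_0 diff_minus_eq_add)
  ultimately show ?thesis
    using assms(2) by (induction A rule: infinite_finite_induct) auto
qed

lemma mats_over_iff:
  "A \<in> mats_over n R \<longleftrightarrow> A \<in> carrier_mat n n \<and> (\<forall>i<n. \<forall>j<n. A $$ (i, j) \<in> R)"
  unfolding mats_over_def elements_mat_def by fastforce

lemma mats_over_add:
  assumes "is_subfield F" "A \<in> mats_over n F" "B \<in> mats_over n F"
  shows "A + B \<in> mats_over n F"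
proof -
  have "x + y \<in> F" if "x \<in> F" "y \<in> F" for x y
    using subfield_sum[OF assms(1), of "{True, False}" "\<lambda>b. if b then x else y"] that by simp
  then show ?thesis using assms(2,3) by (auto simp: mats_over_iff)
qed

lemma mats_over_mult:
  assumes "is_subfield F" "A \<in> mats_over n F" "B \<in> mats_over n F"
  shows "A * B \<in> mats_over n F"
  using assms(2,3) assms(1)[unfolded is_subfield_def]
  by (auto simp: mats_over_iff scalar_prod_def intro!: subfield_sum[OF assms(1)])

text \<open>Full row rank means that the columns span, that is, that \<open>M\<close> is surjective.
  As an equation this can be multiplied by group elements, unlike a statement about
  dimensions.\<close>

lemma rank_eq_iff_right_inverse:
  fixes M :: "'l::field mat"
  assumes M: "M \<in> carrier_mat n m"
  shows "vec_space.rank n M = n \<longleftrightarrow> (\<exists>N \<in> carrier_mat m n. M * N = 1\<^sub>m n)"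
proof -
  interpret vec_space "TYPE('l)" n .
  have cols: "set (cols M) \<subseteq> carrier_vec n" using cols_dim M by blast
  have space: "span (set (cols M)) = {y \<in> carrier_vec n. \<exists>x\<in>carrier_vec m. M *\<^sub>v x = y}"
    using col_space_eq[OF M] M unfolding col_space_def by simp
  show ?thesis
  proof
    assume rank: "rank M = n"
    \<comment> \<open>A maximal independent set of columns has as many elements as the rank; here
      these are n, so it is a basis and the columns span everything.\<close>
    obtain S where S: "maximal S (\<lambda>T. T \<subseteq> set (cols M) \<and> lin_indpt T)"
      using maximal_exists[of "(\<lambda>T. T \<subseteq> set (cols M) \<and> lin_indpt T)" "card (set (cols M))" "{}"]
      by (meson List.finite_set card_mono empty_iff empty_subsetI finite_lin_indpt2 rev_finite_subset)
    then have S': "S \<subseteq> set (cols M)" "lin_indpt S" unfolding maximal_def by auto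
    have "card S = n" using rank_card_indpt[OF M S] rank by simp
    then have "basis S"
      using S' cols finite_subset[OF S'(1)] by (intro dim_li_is_basis) (auto simp: dim_is_n)
    then have "carrier_vec n \<subseteq> span (set (cols M))"
      unfolding basis_def using span_is_monotone[OF S'(1)] by auto
    then have "\<exists>x\<in>carrier_vec m. M *\<^sub>v x = y" if "y \<in> carrier_vec n" for y
      using that space by auto
    then obtain x where x: "\<And>y. y \<in> carrier_vec n \<Longrightarrow> x y \<in> carrier_vec m \<and> M *\<^sub>v x y = y"
      by metis
    \<comment> \<open>The columns of \<open>N\<close> are chosen preimages of the unit
      vectors.\<close>
    define N where "N = mat_of_cols m (map (\<lambda>j. x (unit_vec n j)) [0..<n])"
    have N: "N \<in> carrier_mat m n" unfolding N_def by (intro carrier_matI) simp_all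
    have "M * N = 1\<^sub>m n"
    proof (rule mat_col_eqI)
      fix j assume "j < dim_col (1\<^sub>m n :: 'l mat)"
      then have j: "j < n" by simp
      have "col (M * N) j = M *\<^sub>v col N j" using M N j by (intro col_mult2) auto
      also have "col N j = x (unit_vec n j)"
        unfolding N_def using j x[of "unit_vec n j"] by (subst col_mat_of_cols) auto
      finally show "col (M * N) j = col (1\<^sub>m n) j" using x[of "unit_vec n j"] j by simp
    qed (use M N in auto)
    then show "\<exists>N \<in> carrier_mat m n. M * N = 1\<^sub>m n" using N by auto
  next
    assume "\<exists>N \<in> carrier_mat m n. M * N = 1\<^sub>m n"
    then obtain N where N: "N \<in> carrier_mat m n" "M * N = 1\<^sub>m n" by auto
    have "y \<in> span (set (cols M))" if y: "y \<in> carrier_vec n" for y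
    proof -
      have "M *\<^sub>v (N *\<^sub>v y) = y"
        using y N M by (simp flip: assoc_mult_mat_vec[of _ n m _ n])
      moreover have "N *\<^sub>v y \<in> carrier_vec m" using N y by simp
      ultimately show ?thesis unfolding space using y by blast
    qed
    then have "span (set (cols M)) = carrier_vec n" using space by auto
    moreover have "vs (carrier_vec n) = module_vec TYPE('l) n" by (simp add: module_vec_def)
    ultimately show "rank M = n" unfolding rank_def using dim_is_n by (simp only:)
  qed
qed

text \<open>\<open>U\<close> and \<open>V\<close> are the upper and lower halves of a right inverse
  of (X Y). Their entries may lie outside \<open>F\<close>, as the rank is taken over all of
  \<open>'l\<close>.\<close>

lemma pairs_P_iff:
  fixes F :: "'l::field set"
  shows "(X, Y) \<in> pairs_P F n \<longleftrightarrow> X \<in> mats_over n F \<and> Y \<in> mats_over n F \<and>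
    X * transpose_mat Y = Y * transpose_mat X \<and>
    (\<exists>U\<in>carrier_mat n n. \<exists>V\<in>carrier_mat n n. X * U + Y * V = 1\<^sub>m n)"
proof -
  let ?M = "four_block_mat X Y (0\<^sub>m 0 n) (0\<^sub>m 0 n)"
  have "vec_space.rank n ?M = n \<longleftrightarrow> (\<exists>U\<in>carrier_mat n n. \<exists>V\<in>carrier_mat n n. X * U + Y * V = 1\<^sub>m n)"
    if X: "X \<in> carrier_mat n n" and Y: "Y \<in> carrier_mat n n"
  proof -
    have M: "?M \<in> carrier_mat n (2 * n)" using X Y by (auto simp: mult_2)
    have prod: "?M * four_block_mat U (0\<^sub>m n 0) V (0\<^sub>m n 0) = X * U + Y * V"
      if "U \<in> carrier_mat n n" "V \<in> carrier_mat n n" for U V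
      using X Y that
      by (subst mult_four_block_mat[of _ n n _ n _ 0 _ _ n _ 0]) (auto intro!: eq_matI)
    show ?thesis unfolding rank_eq_iff_right_inverse[OF M]
    proof
      assume "\<exists>N\<in>carrier_mat (2 * n) n. ?M * N = 1\<^sub>m n"
      then obtain N where N: "N \<in> carrier_mat (2 * n) n" "?M * N = 1\<^sub>m n" by auto
      define U V where "U = mat n n (\<lambda>(i, j). N $$ (i, j))" and "V = mat n n (\<lambda>(i, j). N $$ (n + i, j))"
      have "N = four_block_mat U (0\<^sub>m n 0) V (0\<^sub>m n 0)"
        using N(1) by (intro eq_matI) (auto simp: U_def V_def)
      then show "\<exists>U\<in>carrier_mat n n. \<exists>V\<in>carrier_mat n n. X * U + Y * V = 1\<^sub>m n"
        using prod[of U V] N(2) by (intro bexI[of _ U] bexI[of _ V]) (auto simp: U_def V_def)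
    next
      assume "\<exists>U\<in>carrier_mat n n. \<exists>V\<in>carrier_mat n n. X * U + Y * V = 1\<^sub>m n"
      then obtain U V where UV: "U \<in> carrier_mat n n" "V \<in> carrier_mat n n" "X * U + Y * V = 1\<^sub>m n"
        by auto
      then have "four_block_mat U (0\<^sub>m n 0) V (0\<^sub>m n 0) \<in> carrier_mat (2 * n) n"
        by (auto simp: mult_2)
      then show "\<exists>N\<in>carrier_mat (2 * n) n. ?M * N = 1\<^sub>m n" using prod[of U V] UV by auto
    qed
  qed
  then show ?thesis by (auto simp: pairs_P_def mats_over_iff)
qed


lemma Sp_minv:
  assumes "g \<in> Sp n F"
  shows "minv g \<in> Sp n F"
proof -
  let ?N = "2 * n"
  obtain h where h: "h \<in> mats_over ?N F" "g * h = 1\<^sub>m ?N" "h * g = 1\<^sub>m ?N"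
    and g: "g \<in> mats_over ?N F" and J: "transpose_mat g * J_mat n * g = J_mat n"
    using assms unfolding Sp_def GL_def by auto
  have c: "g \<in> carrier_mat ?N ?N" "h \<in> carrier_mat ?N ?N" using g h by (auto simp: mats_over_def)
  note assoc = assoc_mult_mat[of _ ?N ?N _ ?N _ ?N]
  have "transpose_mat h * J_mat n * h = transpose_mat h * (transpose_mat g * J_mat n * g) * h"
    by (simp add: J)
  also have "\<dots> = (transpose_mat h * transpose_mat g) * J_mat n * (g * h)"
    using c by (simp add: assoc mult_carrier_mat[of _ ?N ?N _ ?N])
  also have "transpose_mat h * transpose_mat g = 1\<^sub>m ?N"
    using transpose_mult[OF c] h(2) by simp
  also have "1\<^sub>m ?N * J_mat n * (g * h) = J_mat n"
    using h(2) by (simp add: left_mult_one_mat[of _ ?N ?N] right_mult_one_mat[of _ ?N ?N])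
  finally have "h \<in> Sp n F" using h g unfolding Sp_def GL_def by auto
  then show ?thesis using minv_eqI[OF c h(2)] by simp
qed

lemma Sp_blocksE:
  assumes "g \<in> Sp n F"
  obtains A B C D where "g = four_block_mat A B C D"
    "A \<in> mats_over n F" "B \<in> mats_over n F" "C \<in> mats_over n F" "D \<in> mats_over n F"
proof -
  have g: "g \<in> mats_over (2 * n) F" using assms unfolding Sp_def GL_def by auto
  obtain A B C D where split: "split_block g n n = (A, B, C, D)" by (cases "split_block g n n") auto
  have c: "A \<in> carrier_mat n n" "B \<in> carrier_mat n n" "C \<in> carrier_mat n n" "D \<in> carrier_mat n n"
    and eq: "g = four_block_mat A B C D"
    using split_block[OF split, of n n] g by (auto simp: mats_over_def)
  have entry: "g $$ (i, j) \<in> F" if "i < 2 * n" "j < 2 * n" for i j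
    using g that by (auto simp: mats_over_iff)
  have "A $$ (i, j) \<in> F" "B $$ (i, j) \<in> F" "C $$ (i, j) \<in> F" "D $$ (i, j) \<in> F" if "i < n" "j < n" for i j
    using entry[of i j] entry[of i "n + j"] entry[of "n + i" j] entry[of "n + i" "n + j"] that c
    unfolding eq by auto
  then show ?thesis using eq c that by (auto simp: mats_over_iff)
qed

lemma mult_four_block_square:
  fixes A B C D :: "'l::field mat"
  assumes "A \<in> carrier_mat n n" "B \<in> carrier_mat n n" "C \<in> carrier_mat n n" "D \<in> carrier_mat n n"
    "A' \<in> carrier_mat n n" "B' \<in> carrier_mat n n" "C' \<in> carrier_mat n n" "D' \<in> carrier_mat n n"
    and "four_block_mat A B C D * four_block_mat A' B' C' D' = 1\<^sub>m (2 * n)"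
  shows "A * A' + B * C' = 1\<^sub>m n" "A * B' + B * D' = 0\<^sub>m n n"
    "C * A' + D * C' = 0\<^sub>m n n" "C * B' + D * D' = 1\<^sub>m n"
proof -
  have "four_block_mat (A * A' + B * C') (A * B' + B * D') (C * A' + D * C') (C * B' + D * D')
    = four_block_mat A B C D * four_block_mat A' B' C' D'"
    using assms(1-8) by (subst mult_four_block_mat[of _ n n _ n _ n _ _ n _ n]) auto
  also have "\<dots> = four_block_mat (1\<^sub>m n) (0\<^sub>m n n) (0\<^sub>m n n) (1\<^sub>m n)"
    by (simp add: assms(9) mult_2)
  finally have eq: "four_block_mat (A * A' + B * C') (A * B' + B * D') (C * A' + D * C') (C * B' + D * D')
    = four_block_mat (1\<^sub>m n) (0\<^sub>m n n) (0\<^sub>m n n) (1\<^sub>m n)" .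
  show "A * A' + B * C' = 1\<^sub>m n" "A * B' + B * D' = 0\<^sub>m n n"
    "C * A' + D * C' = 0\<^sub>m n n" "C * B' + D * D' = 1\<^sub>m n"
    using four_block_mat_inject[where n = n, OF _ _ _ _ _ _ _ _ eq] assms(1-8) by auto
qed

text \<open>The new pair is (X Y)g. Its symmetry condition says that (X Y) g J tg t(X Y) vanishes,
  where g J tg = J; a right inverse is obtained from one of (X Y) by applying the inverse of g on
  the left.\<close>

lemma pairs_P_mult_Sp:
  fixes F :: "'l::field set"
  assumes F: "is_subfield F" and g: "four_block_mat A B C D \<in> Sp n F"
    and c: "A \<in> mats_over n F" "B \<in> mats_over n F" "C \<in> mats_over n F" "D \<in> mats_over n F"
    and XY: "(X, Y) \<in> pairs_P F n"
  shows "(X * A + Y * C, X * B + Y * D) \<in> pairs_P F n"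
proof -
  let ?t = transpose_mat and ?g = "four_block_mat A B C D"
  have cc: "A \<in> carrier_mat n n" "B \<in> carrier_mat n n" "C \<in> carrier_mat n n" "D \<in> carrier_mat n n"
    using c by (auto simp: mats_over_def)
  obtain U V where X: "X \<in> mats_over n F" "Y \<in> mats_over n F" and sym: "X * ?t Y = Y * ?t X"
    and UV: "U \<in> carrier_mat n n" "V \<in> carrier_mat n n" "X * U + Y * V = 1\<^sub>m n"
    using XY unfolding pairs_P_iff by auto
  have Xc: "X \<in> carrier_mat n n" "Y \<in> carrier_mat n n" using X by (auto simp: mats_over_def)
  have gc: "?g \<in> carrier_mat (2 * n) (2 * n)" using cc by (simp add: mult_2)
  have "?g * J_mat n * ?t ?g = J_mat n"
    using g gc by (intro symplectic_transpose) (auto simp: Sp_def)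
  \<comment> \<open>The block relations are applied to the transpose of g, which turns relations
    among columns of blocks into relations among rows.\<close>
  then have "?t (four_block_mat (?t A) (?t C) (?t B) (?t D)) * J_mat n
      * four_block_mat (?t A) (?t C) (?t B) (?t D) = J_mat n"
    using cc by (simp add: transpose_four_block_mat[of _ n n _ n _ n])
  from symplectic_blocks[OF _ _ _ _ this] cc
  have rel: "A * ?t B = B * ?t A" "C * ?t D = D * ?t C" "A * ?t D = B * ?t C + 1\<^sub>m n"
    "D * ?t A = C * ?t B + 1\<^sub>m n"
    by simp_all
  note rules = transpose_add[of _ n n] transpose_mult[of _ n n _ n] assoc_mult_mat[of _ n n _ n _ n]
    add_mult_distrib_mat[of _ n n _ _ n] mult_add_distrib_mat[of _ n n _ n]
    mult_carrier_mat[of _ n n _ n] add_carrier_mat[of _ n n] assoc_add_mat[of _ n n]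
    comm_add_mat[of _ n n] mat_add_left_commute[of _ n]
  have assoc: "P * (Q * R) = (P * Q) * R"
    if "P \<in> carrier_mat n n" "Q \<in> carrier_mat n n" "R \<in> carrier_mat n n" for P Q R :: "'l mat"
    using that by simp
  have rel': "A * (?t B * R) = B * (?t A * R)" "C * (?t D * R) = D * (?t C * R)"
    "A * (?t D * R) = B * (?t C * R) + R" "D * (?t A * R) = C * (?t B * R) + R"
    if R: "R \<in> carrier_mat n n" for R
  proof -
    show "A * (?t B * R) = B * (?t A * R)" "C * (?t D * R) = D * (?t C * R)"
      using R cc by (simp_all only: assoc transpose_carrier_mat rel)
    have "A * (?t D * R) = (B * ?t C + 1\<^sub>m n) * R" "D * (?t A * R) = (C * ?t B + 1\<^sub>m n) * R"
      using R cc by (simp_all only: assoc transpose_carrier_mat rel)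
    then show "A * (?t D * R) = B * (?t C * R) + R" "D * (?t A * R) = C * (?t B * R) + R"
      using R cc by (simp_all add: rules)
  qed
  have product_sym: "(X * A + Y * C) * ?t (X * B + Y * D) = (X * B + Y * D) * ?t (X * A + Y * C)"
    using cc Xc by (simp add: rules rel' sym)
  obtain h where h: "?g * h = 1\<^sub>m (2 * n)" "h \<in> Sp n F"
  proof -
    obtain h where h: "?g * h = 1\<^sub>m (2 * n)" "h \<in> carrier_mat (2 * n) (2 * n)"
      using g by (auto simp: Sp_def GL_def mats_over_def)
    then show ?thesis using minv_eqI[OF gc h(2,1)] Sp_minv[OF g] that by auto
  qed
  obtain A' B' C' D' where h': "h = four_block_mat A' B' C' D'"
    and c': "A' \<in> mats_over n F" "B' \<in> mats_over n F" "C' \<in> mats_over n F" "D' \<in> mats_over n F"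
    using Sp_blocksE[OF h(2)] .
  have cc': "A' \<in> carrier_mat n n" "B' \<in> carrier_mat n n" "C' \<in> carrier_mat n n" "D' \<in> carrier_mat n n"
    using c' by (auto simp: mats_over_def)
  note inv = mult_four_block_square[OF cc cc' h(1)[unfolded h']]
  have collect: "A * (A' * R) + B * (C' * R) = R" "A * (B' * R) + B * (D' * R) = 0\<^sub>m n n"
    "C * (A' * R) + D * (C' * R) = 0\<^sub>m n n" "C * (B' * R) + D * (D' * R) = R"
    if "R \<in> carrier_mat n n" for R
    using that cc cc' inv by (simp_all add: assoc flip: add_mult_distrib_mat[of _ n n _ _ n] del: assoc_mult_mat)
  \<comment> \<open>The right factors are the two halves of \<open>h\<close> applied to the stacked
    matrix with blocks \<open>U\<close> and \<open>V\<close>; the grouping on the right exposes the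
    blocks of g * h = 1.\<close>
  have "(X * A + Y * C) * (A' * U + B' * V) + (X * B + Y * D) * (C' * U + D' * V)
    = X * ((A * (A' * U) + B * (C' * U)) + (A * (B' * V) + B * (D' * V)))
    + Y * ((C * (A' * U) + D * (C' * U)) + (C * (B' * V) + D * (D' * V)))"
    using cc cc' UV Xc by (simp add: rules)
  also have "\<dots> = 1\<^sub>m n" unfolding collect[OF UV(1)] collect[OF UV(2)]
    using UV Xc by simp
  finally have right_inverse: "(X * A + Y * C) * (A' * U + B' * V) + (X * B + Y * D) * (C' * U + D' * V) = 1\<^sub>m n" .
  moreover have "A' * U + B' * V \<in> carrier_mat n n" "C' * U + D' * V \<in> carrier_mat n n"
    using cc' UV by auto
  moreover have "X * A + Y * C \<in> mats_over n F" "X * B + Y * D \<in> mats_over n F"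
    using F X c by (auto intro!: mats_over_add mats_over_mult)
  ultimately show ?thesis unfolding pairs_P_iff using product_sym by blast
qed

text \<open>The lower row is (0 1)g, and (0, 1) is itself such a pair.\<close>

lemma Sp_lower_row_pairs_P:
  fixes F :: "'l::field set"
  assumes F: "is_subfield F" and g: "four_block_mat A B C D \<in> Sp n F"
    and c: "A \<in> mats_over n F" "B \<in> mats_over n F" "C \<in> mats_over n F" "D \<in> mats_over n F"
  shows "(C, D) \<in> pairs_P F n"
proof -
  have F01: "1 \<in> F" "0 \<in> F" using F subfield_sum[OF F, of "{}"] by (auto simp: is_subfield_def)
  have cc: "A \<in> carrier_mat n n" "B \<in> carrier_mat n n" "C \<in> carrier_mat n n" "D \<in> carrier_mat n n"
    using c by (auto simp: mats_over_def)
  have "0\<^sub>m n n * 0\<^sub>m n n + 1\<^sub>m n * 1\<^sub>m n = (1\<^sub>m n :: 'l mat)" by simp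
  then have "(0\<^sub>m n n, 1\<^sub>m n) \<in> pairs_P F n"
    unfolding pairs_P_iff using F01 by (auto simp: mats_over_iff intro!: bexI[of _ "0\<^sub>m n n"] bexI[of _ "1\<^sub>m n"])
  from pairs_P_mult_Sp[OF F g c this] show ?thesis using cc by simp
qed

lemma det_jfac_Siegel:
  fixes F :: "'l::field set"
  assumes F: "is_subfield F" and g: "g \<in> Sp n F" and Z: "Z \<in> Siegel F n"
  shows "jfac n g Z \<in> carrier_mat n n" "det (jfac n g Z) \<noteq> 0"
proof -
  obtain A B C D where g': "g = four_block_mat A B C D"
    and c: "A \<in> mats_over n F" "B \<in> mats_over n F" "C \<in> mats_over n F" "D \<in> mats_over n F"
    using Sp_blocksE[OF g] .
  have cc: "A \<in> carrier_mat n n" "B \<in> carrier_mat n n" "C \<in> carrier_mat n n" "D \<in> carrier_mat n n"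
    using c by (auto simp: mats_over_def)
  show "jfac n g Z \<in> carrier_mat n n" "det (jfac n g Z) \<noteq> 0"
    using Sp_lower_row_pairs_P[OF F g[unfolded g'] c] Z cc
    unfolding g' moebius_block[OF cc] by (auto simp: Siegel_def sym_mats_def)
qed

text \<open>The numerator identity is multiplied by the inverse of tj(g, Z) on the left and of j(g,
  W) on the right. The assumptions are symmetry and invertibility only, so that the formula reaches
  the nearby points used for the derivative.\<close>

lemma moebius_diff:
  fixes F :: "'l::field set"
  assumes g: "g \<in> Sp n F" and Z: "Z \<in> sym_mats n" "det (jfac n g Z) \<noteq> 0"
    and W: "W \<in> sym_mats n" "det (jfac n g W) \<noteq> 0"
  shows "moebius n g W - moebius n g Z = transpose_mat (minv (jfac n g Z)) * (W - Z) * minv (jfac n g W)"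
    "moebius n g Z \<in> sym_mats n"
proof -
  let ?t = transpose_mat
  obtain A B C D where g': "g = four_block_mat A B C D"
    and c: "A \<in> mats_over n F" "B \<in> mats_over n F" "C \<in> mats_over n F" "D \<in> mats_over n F"
    using Sp_blocksE[OF g] .
  have cc: "A \<in> carrier_mat n n" "B \<in> carrier_mat n n" "C \<in> carrier_mat n n" "D \<in> carrier_mat n n"
    using c by (auto simp: mats_over_def)
  have "?t g * J_mat n * g = J_mat n" using g by (simp add: Sp_def)
  note rel = symplectic_blocks[OF cc this[unfolded g']]
  note ident = moebius_numerator_identity[OF cc rel]
  \<comment> \<open>The identity produces the transpose of gZ. The formula is kept general in both
    points, because its instance with equal points will remove this transpose.\<close>
  have diff: "moebius n g W = ?t (moebius n g Z) + ?t (minv (jfac n g Z)) * (W - Z) * minv (jfac n g W)"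
    if Z: "Z \<in> sym_mats n" "det (jfac n g Z) \<noteq> 0" and W: "W \<in> sym_mats n" "det (jfac n g W) \<noteq> 0" for Z W
  proof -
    have Zc: "Z \<in> carrier_mat n n" "W \<in> carrier_mat n n" using Z W by (auto simp: sym_mats_def)
    define h k where "h = C * Z + D" and "k = C * W + D"
    define a b where "a = A * Z + B" and "b = A * W + B"
    have hk: "h \<in> carrier_mat n n" "k \<in> carrier_mat n n" "a \<in> carrier_mat n n" "b \<in> carrier_mat n n"
      using cc Zc by (auto simp: h_def k_def a_def b_def)
    have "jfac n g Z = h" "jfac n g W = k" and m: "moebius n g Z = a * minv h" "moebius n g W = b * minv k"
      unfolding g' moebius_block[OF cc] by (simp_all add: h_def k_def a_def b_def)
    then have det: "det h \<noteq> 0" "det k \<noteq> 0" and j: "jfac n g Z = h" "jfac n g W = k" using Z W by auto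
    note h = minv[OF hk(1) det(1)] and k = minv[OF hk(2) det(2)]
    have th: "?t (minv h) * ?t h = 1\<^sub>m n" using transpose_mult[OF hk(1) h(1)] h(2) by simp
    have "?t h * b + Z = ?t a * k + W"
      using ident[OF Z(1) W(1)] by (simp add: h_def k_def a_def b_def)
    then have "?t h * b + Z - Z = ?t a * k + W - Z" by simp
    moreover have "?t h * b + Z - Z = ?t h * b" "?t a * k + W - Z = ?t a * k + (W - Z)"
      using hk Zc by (auto intro!: eq_matI)
    ultimately have e: "?t h * b = ?t a * k + (W - Z)" by simp
    have c: "?t (minv h) \<in> carrier_mat n n" "?t a \<in> carrier_mat n n" "?t h \<in> carrier_mat n n"
      "W - Z \<in> carrier_mat n n"
      using h hk Zc by auto
    have "b * minv k = (?t (minv h) * ?t h) * (b * minv k)" using hk k th by simp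
    also have "\<dots> = ?t (minv h) * (?t h * b) * minv k"
      using hk k h c by (simp add: assoc_mult_mat[of _ n n _ n _ n])
    also have "\<dots> = ?t (minv h) * ?t a * (k * minv k) + ?t (minv h) * (W - Z) * minv k"
      unfolding e using hk k h c
      by (simp add: assoc_mult_mat[of _ n n _ n _ n] add_mult_distrib_mat[of _ n n _ _ n]
          mult_add_distrib_mat[of _ n n _ n])
    also have "?t (minv h) * ?t a * (k * minv k) = ?t (a * minv h)"
      using hk k h c by (simp add: transpose_mult[of _ n n _ n])
    finally show ?thesis unfolding m j .
  qed
  have mc: "moebius n g Z \<in> carrier_mat n n" "minv (jfac n g Z) \<in> carrier_mat n n"
    "minv (jfac n g W) \<in> carrier_mat n n" "moebius n g W \<in> carrier_mat n n"
  proof -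
    have "jfac n g Z \<in> carrier_mat n n" "jfac n g W \<in> carrier_mat n n"
      using cc Z W unfolding g' moebius_block[OF cc] by (auto simp: sym_mats_def)
    then show i: "minv (jfac n g Z) \<in> carrier_mat n n" "minv (jfac n g W) \<in> carrier_mat n n"
      using Z W minv by auto
    have "A * Z + B \<in> carrier_mat n n" "A * W + B \<in> carrier_mat n n"
      using cc Z W by (auto simp: sym_mats_def)
    from mult_carrier_mat[OF this(1) i(1)] mult_carrier_mat[OF this(2) i(2)]
    show "moebius n g Z \<in> carrier_mat n n" "moebius n g W \<in> carrier_mat n n"
      unfolding g' moebius_block[OF cc] .
  qed
  have Zc: "Z \<in> carrier_mat n n" "W \<in> carrier_mat n n" using Z W by (auto simp: sym_mats_def)
  \<comment> \<open>For W = Z the correction term vanishes, and \<open>diff\<close> says that gZ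
    equals its transpose.\<close>
  have "Z - Z = 0\<^sub>m n n" using Zc by (auto intro!: eq_matI)
  then have sym: "?t (moebius n g Z) = moebius n g Z"
    using diff[OF Z Z] mc by (simp add: left_mult_zero_mat[of _ n n] right_mult_zero_mat[of _ n n])
  then show "moebius n g Z \<in> sym_mats n" using mc by (simp add: sym_mats_def)
  let ?R = "?t (minv (jfac n g Z)) * (W - Z) * minv (jfac n g W)"
  have "?R \<in> carrier_mat n n" using mc Zc by auto
  moreover have "moebius n g W = moebius n g Z + ?R" using diff[OF Z W] unfolding sym .
  ultimately show "moebius n g W - moebius n g Z = ?R"
    using mat_add_diff_cancel[OF mc(1)] by simp
qed

text \<open>Multiplying X gZ + Y by j(g, Z) on the right gives (XA + YC)Z + (XB + YD), the
  expression at \<open>Z\<close> of the pair (X Y)g, whose determinant is nonzero.\<close>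

lemma moebius_Siegel:
  fixes F :: "'l::field set"
  assumes F: "is_subfield F" and g: "g \<in> Sp n F" and Z: "Z \<in> Siegel F n"
  shows "moebius n g Z \<in> Siegel F n"
proof -
  obtain A B C D where g': "g = four_block_mat A B C D"
    and c: "A \<in> mats_over n F" "B \<in> mats_over n F" "C \<in> mats_over n F" "D \<in> mats_over n F"
    using Sp_blocksE[OF g] .
  have cc: "A \<in> carrier_mat n n" "B \<in> carrier_mat n n" "C \<in> carrier_mat n n" "D \<in> carrier_mat n n"
    using c by (auto simp: mats_over_def)
  have Zs: "Z \<in> sym_mats n" and Zc: "Z \<in> carrier_mat n n" using Z by (auto simp: Siegel_def sym_mats_def)
  note j = det_jfac_Siegel[OF F g Z]
  note h = minv[OF j]
  have "det (X * moebius n g Z + Y) \<noteq> 0" if XY: "(X, Y) \<in> pairs_P F n" for X Y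
  proof -
    have X: "X \<in> carrier_mat n n" "Y \<in> carrier_mat n n" using XY by (auto simp: pairs_P_def mats_over_def)
    let ?j = "jfac n g Z"
    have m: "moebius n g Z = (A * Z + B) * minv ?j" "?j = C * Z + D"
      unfolding g' moebius_block[OF cc] by simp_all
    have "moebius n g Z \<in> carrier_mat n n" 
      unfolding m(1) using cc Zc h j by (simp add: mult_carrier_mat[of _ n n _ n])
    moreover have "moebius n g Z * ?j = A * Z + B"
      unfolding m(1) using cc Zc h j by (simp add: assoc_mult_mat[of _ n n _ n _ n])
    ultimately have "(X * moebius n g Z + Y) * ?j = X * (A * Z + B) + Y * (C * Z + D)"
      using X j by (simp add: add_mult_distrib_mat[of _ n n _ _ n] assoc_mult_mat[of _ n n _ n _ n] flip: m(2))
    also have "\<dots> = (X * A + Y * C) * Z + (X * B + Y * D)"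
      using X cc Zc by (simp add: assoc_mult_mat[of _ n n _ n _ n]
          add_mult_distrib_mat[of _ n n _ _ n] mult_add_distrib_mat[of _ n n _ n]
          mult_carrier_mat[of _ n n _ n] add_carrier_mat[of _ n n] assoc_add_mat[of _ n n]
          comm_add_mat[of _ n n] mat_add_left_commute[of _ n])
    finally have "det ((X * moebius n g Z + Y) * ?j) \<noteq> 0"
      using pairs_P_mult_Sp[OF F g[unfolded g'] c XY] Z by (auto simp: Siegel_def)
    then show ?thesis
      using det_mult[of "X * moebius n g Z + Y" n ?j] X j \<open>moebius n g Z \<in> carrier_mat n n\<close> by auto
  qed
  then show ?thesis using moebius_diff(2)[OF g Zs j(2) Zs j(2)] by (auto simp: Siegel_def)
qed

section \<open>The derivative of the action\<close>

text \<open>A punctured limit at 0 in the shape used by \<open>partial_deriv\<close>. It is spelled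
  out because the topology comes from the variable \<open>v\<close> and not from the type.\<close>

definition vtends :: "('l::field \<Rightarrow> real) \<Rightarrow> ('l \<Rightarrow> 'l) \<Rightarrow> 'l \<Rightarrow> bool" where
  "vtends v f d \<longleftrightarrow> (\<forall>e>0. \<exists>\<delta>>0. \<forall>t. t \<noteq> 0 \<and> v t < \<delta> \<longrightarrow> v (f t - d) < e)"

context
  fixes v :: "'l::field \<Rightarrow> real"
  assumes v: "nonarch_abs v"
begin

lemma nonarch_nonneg [simp]: "0 \<le> v x" and nonarch_eq_0_iff [simp]: "v x = 0 \<longleftrightarrow> x = 0"
  and nonarch_mult: "v (x * y) = v x * v y" and nonarch_add_le: "v (x + y) \<le> max (v x) (v y)"
  using v unfolding nonarch_abs_def by auto

lemma nonarch_zero [simp]: "v 0 = 0"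
  by simp

lemma nonarch_pos: "x \<noteq> 0 \<Longrightarrow> 0 < v x"
  using nonarch_nonneg[of x] nonarch_eq_0_iff[of x] by (simp only: order_le_less) auto

lemma nonarch_one [simp]: "v 1 = 1"
  using nonarch_mult[of 1 1] nonarch_eq_0_iff[of 1] by simp

lemma nonarch_minus [simp]: "v (- x) = v x"
proof -
  have "v (-1) * v (-1) = 1" by (simp flip: nonarch_mult)
  then have "v (-1) = 1" using nonarch_nonneg[of "-1"] by (metis abs_of_nonneg abs_mult_self_eq power2_eq_square real_sqrt_abs real_sqrt_one)
  then show ?thesis using nonarch_mult[of "-1" x] by simp
qed

lemma vtends_const: "vtends v (\<lambda>t. c) c"
  unfolding vtends_def by (auto intro: exI[of _ 1])

lemma vtends_id: "vtends v (\<lambda>t. t) 0"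
  unfolding vtends_def by auto

lemma vtends_add:
  assumes "vtends v f a" "vtends v g b"
  shows "vtends v (\<lambda>t. f t + g t) (a + b)"
  unfolding vtends_def
proof (intro allI impI)
  fix e :: real assume "e > 0"
  then obtain d1 d2 where d: "d1 > 0" "d2 > 0"
    "\<And>t. t \<noteq> 0 \<Longrightarrow> v t < d1 \<Longrightarrow> v (f t - a) < e" "\<And>t. t \<noteq> 0 \<Longrightarrow> v t < d2 \<Longrightarrow> v (g t - b) < e"
    using assms unfolding vtends_def by metis
  have "v (f t + g t - (a + b)) < e" if "t \<noteq> 0" "v t < min d1 d2" for t
    using nonarch_add_le[of "f t - a" "g t - b"] d(3)[of t] d(4)[of t] that by (auto simp: algebra_simps)
  then show "\<exists>\<delta>>0. \<forall>t. t \<noteq> 0 \<and> v t < \<delta> \<longrightarrow> v (f t + g t - (a + b)) < e"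
    using d(1,2) by (intro exI[of _ "min d1 d2"]) auto
qed

lemma vtends_mult:
  assumes f: "vtends v f a" and g: "vtends v g b"
  shows "vtends v (\<lambda>t. f t * g t) (a * b)"
  unfolding vtends_def
proof (intro allI impI)
  fix e :: real assume e: "e > 0"
  \<comment> \<open>\<open>M\<close> bounds v a strictly and also v (g t) near 0: the cap 1 in
    \<open>e'\<close> keeps g t - b below \<open>M\<close>, and the ultrametric inequality does the
    rest.\<close>
  define M where "M = 1 + v a + v b"
  have M: "M \<ge> 1" "v a < M" "v b < M" by (simp_all add: M_def add_pos_nonneg add_nonneg_pos)
  define e' where "e' = min 1 (e / M)"
  have "e' > 0" using e M by (simp add: e'_def)
  then obtain d1 d2 where d: "d1 > 0" "d2 > 0"
    "\<And>t. t \<noteq> 0 \<Longrightarrow> v t < d1 \<Longrightarrow> v (f t - a) < e'" "\<And>t. t \<noteq> 0 \<Longrightarrow> v t < d2 \<Longrightarrow> v (g t - b) < e'"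
    using f g unfolding vtends_def by metis
  have "v (f t * g t - a * b) < e" if "t \<noteq> 0" "v t < min d1 d2" for t
  proof -
    have ft: "v (f t - a) < e'" and gt: "v (g t - b) < e'" using d(3)[of t] d(4)[of t] that by auto
    have "v (g t) \<le> max (v (g t - b)) (v b)" using nonarch_add_le[of "g t - b" b] by simp
    also have "\<dots> \<le> M" using gt M by (auto simp: e'_def)
    finally have "v ((f t - a) * g t) \<le> v (f t - a) * M"
      unfolding nonarch_mult by (intro mult_left_mono) auto
    also have "\<dots> < e' * M" using ft M by (intro mult_strict_right_mono) auto
    also have "\<dots> \<le> e" using M e by (auto simp: e'_def min_def field_simps)
    finally have 1: "v ((f t - a) * g t) < e" .
    have "v (a * (g t - b)) \<le> M * v (g t - b)"
      unfolding nonarch_mult using M by (intro mult_right_mono) auto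
    also have "\<dots> < M * e'" using gt M by (intro mult_strict_left_mono) auto
    also have "\<dots> \<le> e" using M e by (auto simp: e'_def min_def field_simps)
    finally have 2: "v (a * (g t - b)) < e" .
    have "f t * g t - a * b = (f t - a) * g t + a * (g t - b)" by (simp add: algebra_simps)
    then show ?thesis using nonarch_add_le[of "(f t - a) * g t" "a * (g t - b)"] 1 2 by simp
  qed
  then show "\<exists>\<delta>>0. \<forall>t. t \<noteq> 0 \<and> v t < \<delta> \<longrightarrow> v (f t * g t - a * b) < e"
    using d(1,2) by (intro exI[of _ "min d1 d2"]) auto
qed

lemma vtends_sum:
  assumes "\<And>i. i \<in> A \<Longrightarrow> vtends v (f i) (a i)"
  shows "vtends v (\<lambda>t. \<Sum>i\<in>A. f i t) (\<Sum>i\<in>A. a i)"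
  using assms
  by (induction A rule: infinite_finite_induct) (auto intro: vtends_const vtends_add)

lemma vtends_prod:
  assumes "\<And>i. i \<in> A \<Longrightarrow> vtends v (f i) (a i)"
  shows "vtends v (\<lambda>t. \<Prod>i\<in>A. f i t) (\<Prod>i\<in>A. a i)"
  using assms
  by (induction A rule: infinite_finite_induct) (auto intro: vtends_const vtends_mult)

text \<open>Once f t is closer to \<open>a\<close> than the size of \<open>a\<close>, the
  ultrametric inequality forces equal absolute values. This keeps determinants away from 0 near the
  limit point.\<close>

lemma vtends_nonzero:
  assumes "vtends v f a" "a \<noteq> 0"
  obtains \<delta> where "\<delta> > 0" "\<And>t. t \<noteq> 0 \<Longrightarrow> v t < \<delta> \<Longrightarrow> v (f t) = v a"
proof -
  have "v a > 0" using assms(2) by (rule nonarch_pos)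
  then obtain \<delta> where \<delta>: "\<delta> > 0" "\<And>t. t \<noteq> 0 \<Longrightarrow> v t < \<delta> \<Longrightarrow> v (f t - a) < v a"
    using assms(1) unfolding vtends_def by metis
  have "v (f t) = v a" if "t \<noteq> 0" "v t < \<delta>" for t
  proof -
    have "v (f t - a) < v a" using \<delta> that by auto
    moreover have "v a \<le> max (v (f t)) (v (f t - a))"
      using nonarch_add_le[of "f t" "- (f t - a)"] nonarch_minus[of "f t - a"] by simp
    moreover have "v (f t) \<le> max (v (f t - a)) (v a)"
      using nonarch_add_le[of "f t - a" a] by simp
    ultimately show ?thesis by linarith
  qed
  then show ?thesis using \<delta>(1) that by blast
qed

lemma vtends_inverse:
  assumes f: "vtends v f a" and a: "a \<noteq> 0"
  shows "vtends v (\<lambda>t. inverse (f t)) (inverse a)"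
  unfolding vtends_def
proof (intro allI impI)
  fix e :: real assume e: "e > 0"
  have va: "v a > 0" using a by (rule nonarch_pos)
  obtain d1 where d1: "d1 > 0" "\<And>t. t \<noteq> 0 \<Longrightarrow> v t < d1 \<Longrightarrow> v (f t) = v a"
    using vtends_nonzero[OF f a] by blast
  \<comment> \<open>The difference of the inverses, multiplied by f t and \<open>a\<close>, is -(f t
    - a); near 0 both multipliers have absolute value v a.\<close>
  have "e * v a * v a > 0" using e va by simp
  then obtain d2 where d2: "d2 > 0" "\<And>t. t \<noteq> 0 \<Longrightarrow> v t < d2 \<Longrightarrow> v (f t - a) < e * v a * v a"
    using f unfolding vtends_def by metis
  have "v (inverse (f t) - inverse a) < e" if t: "t \<noteq> 0" "v t < min d1 d2" for t
  proof -
    have ft: "v (f t) = v a" using d1 t by auto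
    then have "f t \<noteq> 0" using va nonarch_eq_0_iff[of "f t"] by auto
    then have "(inverse (f t) - inverse a) * f t * a = - (f t - a)"
      using a by (simp add: field_simps)
    then have "v (inverse (f t) - inverse a) * v a * v a = v (f t - a)"
      using ft by (metis nonarch_minus nonarch_mult)
    then have "v (inverse (f t) - inverse a) * (v a * v a) < e * (v a * v a)"
      using d2(2)[of t] t by (simp add: mult.assoc)
    then show ?thesis using va by (simp add: mult_less_cancel_right_pos)
  qed
  then show "\<exists>\<delta>>0. \<forall>t. t \<noteq> 0 \<and> v t < \<delta> \<longrightarrow> v (inverse (f t) - inverse a) < e"
    using d1(1) d2(1) by (intro exI[of _ "min d1 d2"]) auto
qed

lemma vtends_cong:
  assumes "vtends v f a" "\<delta> > 0" "\<And>t. t \<noteq> 0 \<Longrightarrow> v t < \<delta> \<Longrightarrow> f t = g t"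
  shows "vtends v g a"
  unfolding vtends_def
proof (intro allI impI)
  fix e :: real assume "e > 0"
  then obtain d where d: "d > 0" "\<And>t. t \<noteq> 0 \<Longrightarrow> v t < d \<Longrightarrow> v (f t - a) < e"
    using assms(1) unfolding vtends_def by metis
  have "v (g t - a) < e" if "t \<noteq> 0" "v t < min d \<delta>" for t
    using d(2)[of t] assms(3)[of t] that by simp
  then show "\<exists>\<delta>>0. \<forall>t. t \<noteq> 0 \<and> v t < \<delta> \<longrightarrow> v (g t - a) < e"
    using d(1) assms(2) by (intro exI[of _ "min d \<delta>"]) auto
qed

text \<open>Powers of \<open>\<pi>\<close> are nonzero points arbitrarily close to 0, at which the
  two approximations contradict each other.\<close>

lemma vtends_unique:
  assumes \<pi>: "\<pi> \<noteq> 0" "v \<pi> < 1" and a: "vtends v f a" and b: "vtends v f b"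
  shows "a = b"
proof (rule ccontr)
  assume "a \<noteq> b"
  then have e: "v (a - b) > 0" by (intro nonarch_pos) simp
  then obtain d1 d2 where d: "d1 > 0" "d2 > 0"
    "\<And>t. t \<noteq> 0 \<Longrightarrow> v t < d1 \<Longrightarrow> v (f t - a) < v (a - b)"
    "\<And>t. t \<noteq> 0 \<Longrightarrow> v t < d2 \<Longrightarrow> v (f t - b) < v (a - b)"
    using a b unfolding vtends_def by metis
  have "min d1 d2 > 0" using d by simp
  then obtain k where k: "v \<pi> ^ k < min d1 d2"
    using real_arch_pow_inv[OF _ \<pi>(2)] by blast
  have "v (\<pi> ^ k) = v \<pi> ^ k" by (induction k) (simp_all add: nonarch_mult)
  then have "v (f (\<pi> ^ k) - a) < v (a - b)" "v (f (\<pi> ^ k) - b) < v (a - b)"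
    using d(3,4)[of "\<pi> ^ k"] k \<pi>(1) by auto
  moreover have "v (a - b) \<le> max (v (f (\<pi> ^ k) - a)) (v (f (\<pi> ^ k) - b))"
    using nonarch_add_le[of "- (f (\<pi> ^ k) - a)" "f (\<pi> ^ k) - b"] nonarch_minus[of "f (\<pi> ^ k) - a"] by simp
  ultimately show False by linarith
qed

lemma vtends_det:
  assumes M: "\<And>t. M t \<in> carrier_mat n n" "M0 \<in> carrier_mat n n"
    and lim: "\<And>i j. i < n \<Longrightarrow> j < n \<Longrightarrow> vtends v (\<lambda>t. M t $$ (i, j)) (M0 $$ (i, j))"
  shows "vtends v (\<lambda>t. det (M t)) (det M0)"
  unfolding det_def'[OF M(1)] det_def'[OF M(2)]
proof (intro vtends_sum vtends_mult vtends_prod vtends_const lim)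
  fix q i assume "q \<in> {q. q permutes {0..<n}}" "i \<in> {0..<n}"
  then show "q i < n" using permutes_in_image[of q "{0..<n}" i] by simp
qed simp

text \<open>Cramer's rule, which makes the entries of the inverse rational in those of
  \<open>A\<close> and hence accessible to the limit rules. The adjugate accounts for the exchanged
  indices.\<close>

lemma minv_cofactor:
  fixes A :: "'l mat"
  assumes A: "A \<in> carrier_mat n n" and det: "det A \<noteq> 0" and ij: "i < n" "j < n"
  shows "minv A $$ (i, j) = inverse (det A) * ((-1) ^ (j + i) * det (mat_delete A j i))"
proof -
  have "A * (inverse (det A) \<cdot>\<^sub>m adj_mat A) = 1\<^sub>m n"
    using adj_mat[OF A] A det by (auto simp: mult_smult_distrib[of _ n n _ n] intro!: eq_matI)
  then have "minv A = inverse (det A) \<cdot>\<^sub>m adj_mat A"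
    using adj_mat[OF A] A by (intro minv_eqI) auto
  then show ?thesis using A ij by (simp add: adj_mat_def cofactor_def)
qed

lemma vtends_minv:
  assumes M: "\<And>t. M t \<in> carrier_mat n n" "M0 \<in> carrier_mat n n" and det: "det M0 \<noteq> 0"
    and lim: "\<And>i j. i < n \<Longrightarrow> j < n \<Longrightarrow> vtends v (\<lambda>t. M t $$ (i, j)) (M0 $$ (i, j))"
    and ij: "i < n" "j < n"
  shows "vtends v (\<lambda>t. minv (M t) $$ (i, j)) (minv M0 $$ (i, j))"
proof -
  have d: "vtends v (\<lambda>t. det (M t)) (det M0)" by (rule vtends_det[OF M lim])
  then obtain \<delta> where \<delta>: "\<delta> > 0" "\<And>t. t \<noteq> 0 \<Longrightarrow> v t < \<delta> \<Longrightarrow> v (det (M t)) = v (det M0)"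
    using vtends_nonzero[OF _ det] by blast
  have del: "vtends v (\<lambda>t. det (mat_delete (M t) j i)) (det (mat_delete M0 j i))"
  proof (rule vtends_det)
    show "mat_delete (M t) j i \<in> carrier_mat (n - 1) (n - 1)" for t
      using carrier_matD[OF M(1)] carrier_matD[OF M(2)] by (simp add: mat_delete_def)
    show "mat_delete M0 j i \<in> carrier_mat (n - 1) (n - 1)"
      using carrier_matD[OF M(1)] carrier_matD[OF M(2)] by (simp add: mat_delete_def)
    fix a b assume "a < n - 1" "b < n - 1"
    then show "vtends v (\<lambda>t. mat_delete (M t) j i $$ (a, b)) (mat_delete M0 j i $$ (a, b))"
      using M by (auto simp: mat_delete_def carrier_matD[OF M(1)] carrier_matD[OF M(2)] intro!: lim)
  qed
  have "vtends v (\<lambda>t. inverse (det (M t)) * ((-1) ^ (j + i) * det (mat_delete (M t) j i)))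
     (inverse (det M0) * ((-1) ^ (j + i) * det (mat_delete M0 j i)))"
    by (intro vtends_mult vtends_inverse d det vtends_const del)
  \<comment> \<open>Away from 0 the matrix M t may be singular and \<open>minv\<close> arbitrary;
    Cramer's rule describes it only within \<open>\<delta>\<close>, which is enough for the
    limit.\<close>
  then show ?thesis unfolding minv_cofactor[OF M(2) det ij, symmetric]
  proof (rule vtends_cong[OF _ \<delta>(1)])
    fix t assume "t \<noteq> 0" "v t < \<delta>"
    then have "det (M t) \<noteq> 0" using \<delta>(2) det by (metis nonarch_eq_0_iff)
    then show "inverse (det (M t)) * ((-1) ^ (j + i) * det (mat_delete (M t) j i)) = minv (M t) $$ (i, j)"
      using minv_cofactor[OF M(1) _ ij] by simp
  qed
qed

end

section \<open>Partial derivatives of the action\<close>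

text \<open>The direction \<open>E\<close> of \<open>partial_deriv\<close>: moving Z along it
  changes the coordinate at (i, j) and, to preserve symmetry, its mirror image.\<close>

definition sym_unit :: "nat \<Rightarrow> nat \<times> nat \<Rightarrow> 'l::field mat" where
  "sym_unit n = (\<lambda>(i, j). mat n n (\<lambda>c. if c = (i, j) \<or> c = (j, i) then 1 else 0))"

lemma sym_unit_sym_mats: "sym_unit n b \<in> sym_mats n"
  by (cases b) (auto simp: sym_unit_def sym_mats_def intro!: eq_matI)

lemma partial_derivI:
  assumes "nonarch_abs v" "\<pi> \<noteq> 0" "v \<pi> < 1"
    and "vtends v (\<lambda>t. (f (Z + t \<cdot>\<^sub>m sym_unit n b) - f Z) / t) d"
  shows "partial_deriv v n f b Z = d"
proof -
  have "partial_deriv v n f b Z = (THE d. vtends v (\<lambda>t. (f (Z + t \<cdot>\<^sub>m sym_unit n b) - f Z) / t) d)"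
    by (cases b) (simp add: partial_deriv_def vtends_def sym_unit_def)
  also have "\<dots> = d"
    using assms by (intro the_equality) (auto intro: vtends_unique[OF assms(1-3)])
  finally show ?thesis .
qed

text \<open>Substituting this direction for dZ in tH dZ H isolates the coefficient of a single basis
  one-form.\<close>

lemma congruence_sym_unit:
  fixes H :: "'l::field mat"
  assumes H: "H \<in> carrier_mat n n" and b: "b \<in> idx n" and c: "c \<in> idx n"
  shows "(transpose_mat H * sym_unit n c * H) $$ b = sigma1_coeff n H b c"
proof -
  obtain k l i j where bc: "b = (k, l)" "k \<le> l" "l < n" "c = (i, j)" "i \<le> j" "j < n"
    using b c by (auto simp: idx_def)
  have "(transpose_mat H * sym_unit n c * H) $$ b
    = (\<Sum>q<n. \<Sum>p<n. transpose_mat H $$ (k, p) * sym_unit n c $$ (p, q) * H $$ (q, l))"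
    unfolding bc(1) using H bc by (intro index_mult3) (auto simp: sym_unit_def)
  \<comment> \<open>The inner test on i = j keeps a diagonal unit from being counted twice.\<close>
  also have "\<dots> = (\<Sum>q<n. \<Sum>p<n.
      (if p = i then if q = j then H $$ (p, k) * H $$ (q, l) else 0 else 0)
    + (if p = j then if q = i then if i = j then 0 else H $$ (p, k) * H $$ (q, l) else 0 else 0))"
  proof (intro sum.cong refl, goal_cases)
    case (1 q p)
    then show ?case using H bc by (auto simp: sym_unit_def)
  qed
  also have "\<dots> = sigma1_coeff n H b c"
    using bc by (simp add: sum.distrib sigma1_coeff_def idx_def)
  finally show ?thesis .
qed

text \<open>For small nonzero \<open>t\<close> the difference quotient is exactly an entry of tH E
  k, where H is the inverse of j(g, Z) and k that of j(g, Z + tE). Continuity of inversion sends k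
  to H.\<close>

lemma partial_deriv_moebius:
  fixes v :: "'l::field \<Rightarrow> real"
  assumes v: "nonarch_abs v" and \<pi>: "\<pi> \<noteq> 0" "v \<pi> < 1" and F: "is_subfield F"
    and g: "g \<in> Sp n F" and Z: "Z \<in> Siegel F n" and b: "b \<in> idx n" and c: "c \<in> idx n"
  shows "partial_deriv v n (\<lambda>W. moebius n g W $$ b) c Z = sigma1_coeff n (minv (jfac n g Z)) b c"
proof (rule partial_derivI[OF v \<pi>])
  let ?E = "sym_unit n c :: 'l mat" and ?H = "minv (jfac n g Z)" and ?t = transpose_mat
  define Zt where "Zt t = Z + t \<cdot>\<^sub>m ?E" for t
  obtain k l where kl: "b = (k, l)" "k < n" "l < n" using b by (auto simp: idx_def)
  obtain A B C D where g': "g = four_block_mat A B C D"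
    and bl: "A \<in> mats_over n F" "B \<in> mats_over n F" "C \<in> mats_over n F" "D \<in> mats_over n F"
    using Sp_blocksE[OF g] .
  have cc: "A \<in> carrier_mat n n" "B \<in> carrier_mat n n" "C \<in> carrier_mat n n" "D \<in> carrier_mat n n"
    using bl by (auto simp: mats_over_def)
  have Zs: "Z \<in> sym_mats n" and Zc: "Z \<in> carrier_mat n n" using Z by (auto simp: Siegel_def sym_mats_def)
  have Ec: "?E \<in> carrier_mat n n" "?t ?E = ?E" using sym_unit_sym_mats[of n c] by (auto simp: sym_mats_def)
  have Ztc: "Zt t \<in> carrier_mat n n" for t using Zc Ec by (simp add: Zt_def)
  have "?t (Zt t) = Zt t" for t
  proof -
    have "?t (t \<cdot>\<^sub>m ?E) = t \<cdot>\<^sub>m ?t ?E" by (intro eq_matI) auto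
    then show ?thesis using Zc Ec Zs by (simp add: Zt_def sym_mats_def transpose_add[of _ n n])
  qed
  then have Zts: "Zt t \<in> sym_mats n" for t using Ztc by (simp add: sym_mats_def)
  note j = det_jfac_Siegel[OF F g Z]
  have jt: "jfac n g (Zt t) \<in> carrier_mat n n" for t
    unfolding g' moebius_block[OF cc] using cc Ztc by (simp add: mult_carrier_mat[of _ n n _ n])
  have jE: "jfac n g (Zt t) = jfac n g Z + t \<cdot>\<^sub>m (C * ?E)" for t
    unfolding g' moebius_block[OF cc] Zt_def using cc Zc Ec
    by (simp add: mult_add_distrib_mat[of _ n n _ n] mult_smult_distrib[of _ n n _ n]
        assoc_add_mat[of _ n n] comm_add_mat[of _ n n] mult_carrier_mat[of _ n n _ n])
  have lim: "vtends v (\<lambda>t. jfac n g (Zt t) $$ (p, q)) (jfac n g Z $$ (p, q))" if "p < n" "q < n" for p q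
  proof -
    have "vtends v (\<lambda>t. jfac n g Z $$ (p, q) + t * (C * ?E) $$ (p, q))
      (jfac n g Z $$ (p, q) + 0 * (C * ?E) $$ (p, q))"
      by (intro vtends_add vtends_mult vtends_const vtends_id v)
    moreover have "jfac n g (Zt t) $$ (p, q) = jfac n g Z $$ (p, q) + t * (C * ?E) $$ (p, q)" for t
      unfolding jE using that j(1) cc Ec mult_carrier_mat[OF cc(3) Ec(1)] by (simp del: index_mult_mat(1))
    ultimately show ?thesis by simp
  qed
  \<comment> \<open>Within \<open>\<delta>\<close> the determinant at Z + tE is nonzero, which is
    all that \<open>moebius_diff\<close> requires of the displaced point.\<close>
  obtain \<delta> where \<delta>: "\<delta> > 0" "\<And>t. t \<noteq> 0 \<Longrightarrow> v t < \<delta> \<Longrightarrow> v (det (jfac n g (Zt t))) = v (det (jfac n g Z))"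
    using vtends_nonzero[OF v vtends_det[OF v jt j(1) lim] j(2)] by blast
  note H = minv[OF j]
  have "vtends v (\<lambda>t. \<Sum>q<n. \<Sum>p<n. ?t ?H $$ (k, p) * ?E $$ (p, q) * minv (jfac n g (Zt t)) $$ (q, l))
     (\<Sum>q<n. \<Sum>p<n. ?t ?H $$ (k, p) * ?E $$ (p, q) * ?H $$ (q, l))"
    using kl by (intro vtends_sum vtends_mult vtends_const v vtends_minv[OF v jt j lim]) auto
  moreover have "(\<Sum>q<n. \<Sum>p<n. ?t ?H $$ (k, p) * ?E $$ (p, q) * ?H $$ (q, l)) = sigma1_coeff n ?H b c"
    unfolding congruence_sym_unit[OF H(1) b c, symmetric] unfolding kl(1)
    using H(1) Ec(1) kl by (intro index_mult3[symmetric]) auto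
  ultimately have "vtends v (\<lambda>t. \<Sum>q<n. \<Sum>p<n. ?t ?H $$ (k, p) * ?E $$ (p, q) * minv (jfac n g (Zt t)) $$ (q, l))
     (sigma1_coeff n ?H b c)"
    by simp
  then show "vtends v (\<lambda>t. (moebius n g (Z + t \<cdot>\<^sub>m ?E) $$ b - moebius n g Z $$ b) / t) (sigma1_coeff n ?H b c)"
    unfolding Zt_def[symmetric]
  proof (rule vtends_cong[OF v _ \<delta>(1)])
    fix t assume t: "t \<noteq> 0" "v t < \<delta>"
    then have det: "det (jfac n g (Zt t)) \<noteq> 0" using \<delta>(2) j(2) nonarch_eq_0_iff[OF v] by metis
    note Ht = minv[OF jt det]
    have "Zt t - Z = t \<cdot>\<^sub>m ?E" unfolding Zt_def using Zc Ec by (simp add: mat_add_diff_cancel[of _ n])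
    then have "moebius n g (Zt t) - moebius n g Z = ?t ?H * (t \<cdot>\<^sub>m ?E) * minv (jfac n g (Zt t))"
      using moebius_diff(1)[OF g Zs j(2) Zts det] by simp
    also have "\<dots> = t \<cdot>\<^sub>m (?t ?H * ?E * minv (jfac n g (Zt t)))"
      using H Ht Ec by (simp add: mult_smult_distrib[of _ n n _ n] mult_smult_assoc_mat[of _ n n _ n])
    finally have diff: "moebius n g (Zt t) - moebius n g Z = t \<cdot>\<^sub>m (?t ?H * ?E * minv (jfac n g (Zt t)))" .
    define R where "R = ?t ?H * ?E * minv (jfac n g (Zt t))"
    have "R \<in> carrier_mat n n" using H Ht Ec by (simp add: R_def mult_carrier_mat[of _ n n _ n])
    moreover have "moebius n g Z \<in> carrier_mat n n"
      using moebius_diff(2)[OF g Zs j(2) Zs j(2)] by (simp add: sym_mats_def)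
    ultimately have "moebius n g (Zt t) $$ b - moebius n g Z $$ b = t * R $$ b"
      using arg_cong[OF diff[folded R_def], of "\<lambda>M. M $$ b"] kl by simp
    moreover have "R $$ b = (\<Sum>q<n. \<Sum>p<n. ?t ?H $$ (k, p) * ?E $$ (p, q) * minv (jfac n g (Zt t)) $$ (q, l))"
      unfolding R_def kl(1) using H Ht Ec kl by (intro index_mult3) auto
    ultimately show "(\<Sum>q<n. \<Sum>p<n. ?t ?H $$ (k, p) * ?E $$ (p, q) * minv (jfac n g (Zt t)) $$ (q, l))
      = (moebius n g (Zt t) $$ b - moebius n g Z $$ b) / t"
      using t by simp
  qed
qed

section \<open>Comparison of the two actions\<close>

theorem proposition1p17:
  fixes v :: "'l::{alg_closed_field, field_char_0} \<Rightarrow> real"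
    and F K :: "'l set" and \<pi> :: 'l and p n r :: nat
  assumes "0 < n"
    and "nonarch_abs v" and "complete_for v (UNIV :: 'l set)"
    and "finite_extension_Qp p v F" and "normalized_on v F" and "uniformizer v F \<pi>"
    and "is_subfield K" and "F \<subseteq> K" and "complete_for v K"
    and "1 \<le> r" and "r \<le> n * (n + 1) div 2"
  shows "K_rational_rep F K n (ext_basis (idx n) r) (sigma_r n r) \<and>
    (\<forall>g \<in> Sp n F. \<forall>\<omega> \<in> rigid_forms v F K \<pi> n r.
       forms_action v F n r g \<omega> =
       hol_disc_series F n (ext_basis (idx n) r) (sigma_r n r) g \<omega>)"
proof (intro conjI ballI)
  show "K_rational_rep F K n (ext_basis (idx n) r) (sigma_r n r)"
    by (rule K_rational_rep_sigma_r[OF \<open>is_subfield K\<close>])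
  let ?B = "ext_basis (idx n) r"
  fix g \<omega> assume g: "g \<in> Sp n F" and \<omega>: "\<omega> \<in> rigid_forms v F K \<pi> n r"
  have F: "is_subfield F" using assms(4) by (simp add: finite_extension_Qp_def)
  have \<pi>: "\<pi> \<noteq> 0" "v \<pi> < 1" using assms(6) by (auto simp: uniformizer_def)
  let ?g = "minv g"
  have g': "?g \<in> Sp n F" by (rule Sp_minv[OF g])
  have "pullback v n r (moebius n ?g) \<omega> Z = inv_into (coord_space ?B) (sigma_r n r (jfac n ?g Z)) (\<omega> (moebius n ?g Z))"
    if Z: "Z \<in> Siegel F n" for Z
  proof -
    let ?j = "jfac n ?g Z" and ?u = "\<omega> (moebius n ?g Z)"
    note j = det_jfac_Siegel[OF F g' Z]
    note H = minv[OF j]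
    \<comment> \<open>Invariance of the half-space enters here: the values of the form are
      controlled only at points of it.\<close>
    have u: "?u \<in> coord_space ?B"
      using \<omega> moebius_Siegel[OF F g' Z] by (auto simp: rigid_forms_def O_tensor_def)
    have "differential v n (\<lambda>W. moebius n ?g W $$ b) Z = sigma1_coeff n (minv ?j) b" if b: "b \<in> idx n" for b
    proof
      fix c show "differential v n (\<lambda>W. moebius n ?g W $$ b) Z c = sigma1_coeff n (minv ?j) b c"
        using partial_deriv_moebius[OF assms(2) \<pi> F g' Z b, of c]
        by (cases "c \<in> idx n") (auto simp: differential_def sigma1_coeff_def split: prod.splits)
    qed
    then have "pullback v n r (moebius n ?g) \<omega> Z = ext_map (idx n) r (sigma1_coeff n (minv ?j)) ?u"
      unfolding pullback_def by (intro fun_cong[OF ext_map_cong] finite_idx)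
    also have "\<dots> = sigma_r n r (minv ?j) ?u" by (simp add: sigma_r_coeff[OF H(1)])
    also have "\<dots> = inv_into (coord_space ?B) (sigma_r n r ?j) ?u"
    \<comment> \<open>Both composites of \<open>sigma_r\<close> at j and at its inverse are the
      identity on \<open>coord_space ?B\<close>, by multiplicativity; one order gives injectivity,
      the other identifies the preimage.\<close>
    proof (rule inv_into_f_eq[symmetric])
      show "inj_on (sigma_r n r ?j) (coord_space ?B)"
      proof (rule inj_on_inverseI)
        fix w :: "(nat \<times> nat) set \<Rightarrow> 'l" assume "w \<in> coord_space ?B"
        then show "sigma_r n r (minv ?j) (sigma_r n r ?j w) = w"
          using sigma_r_mult[OF H(1) j(1), of r w] H(3) by (simp add: sigma_r_one)
      qed
      show "sigma_r n r (minv ?j) ?u \<in> coord_space ?B" by (rule sigma_r_coord_space)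
      show "sigma_r n r ?j (sigma_r n r (minv ?j) ?u) = ?u"
        using sigma_r_mult[OF j(1) H(1), of r ?u] H(2) u by (simp add: sigma_r_one)
    qed
    finally show ?thesis .
  qed
  then show "forms_action v F n r g \<omega> = hol_disc_series F n ?B (sigma_r n r) g \<omega>"
    by (simp add: forms_action_def hol_disc_series_def cong: restrict_cong)
qed

end
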